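(* Suppose $C\in\mathbb{R}^{N\times N}$ is symmetric positive semi-definite and $G\in\mathbb{R}^{N\times N}$ is positive definite (not necessarily symmetric). Let $\gamma>0$, $B=G^{-1}C$ and $S=P_C(C+\gamma G)^{-1}C$. Then $\mathcal F_C(B)$ is bounded by a disk $\mathcal D(c_1,\rho_1)$ with a real number $c_1>\rho_1$, i.e., $0$ is not inside $\mathcal F_C(B)$, and thus $\mathcal F_C(S)$ is bounded by a disk $\mathcal D(c_0,\rho_0)$ with $c_0>\rho_0$. Take $\Gamma$ to be the circle with center $c_0$ and radius $r\in(\rho_0,c_0)$. Then $$\|x_{\mathcal R}(t)-x_a(t)\|_C\le\max_{\lambda\in\Gamma}\Bigl(|f(\lambda)|\,\|x(0)\|_C+|f_1(\lambda)|\,\|u(0)\|_C+|f_2(\lambda)|\,\|u'(0)\|_C\Bigr)\cdot\frac{4}{r-\rho_0}\left(\frac{\rho_0}{r}\right)^m,$$ where $x_{\mathcal R}(t)$ is the projected solution and $x_a(t)$ its $m$-dimensional Krylov approximation, both defined in the context.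
   Context: A real square matrix $G$ is positive definite if $v^\top Gv>0$ for every nonzero real $v$. Let $n$ be the rank of $C$ and $C=V_CC_1V_C^\top$ its reduced eigenvector decomposition ($V_C\in\mathbb{R}^{N\times n}$ with orthonormal columns spanning the range of $C$, $C_1$ diagonal with positive entries); $P_C=V_CV_C^\top$. $\|x\|_C=\sqrt{x^*Cx}$; for $A=KC$ with $K\in\mathbb{R}^{N\times N}$, $\mathcal F_C(A)=\{x^*CAx:x\in\mathbb{C}^N,\|x\|_C\le1\}$; $\mathcal D(c,\rho)\subset\mathbb{C}$ is the disk with center $c$ and radius $\rho>0$. The disk for $S$ is obtained from that for $B$ as follows: with $g(\mu)=(1+\gamma\mu^{-1})^{-1}$, $\mu_1=c_1-\rho_1>0$, $\mu_2=c_1+\rho_1$, one has $c_0=(g(\mu_1)+g(\mu_2))/2$ and $\rho_0=(g(\mu_2)-g(\mu_1))/2$. Phi-functions: $\varphi_0(z)=e^z$, $\varphi_{k+1}(z)=(\varphi_k(z)-1/k!)/z$. With $g_1(\lambda)^{-1}=(\lambda^{-1}-1)/\gamma$, set $f(\lambda)=\varphi_0(-t\,g_1(\lambda)^{-1})$ and $f_k(\lambda)=g_1(\lambda)^{-1}\varphi_k(-t\,g_1(\lambda)^{-1})$, $k=1,2$; for invertible matrices $M$ these are evaluated by replacing $g_1(\lambda)^{-1}$ with $(M^{-1}-I)/\gamma$. The underlying system is $C\dot x+Gx=u(t)$ with initial value $x(0)\in\mathbb{R}^N$ and linear source $u(s)=u(0)+s\,u'(0)$. With $B_{1,1}=V_C^\top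 G^{-1}CV_C$, the projected solution is $$x_{\mathcal R}(t)=V_C\exp(-tB_{1,1}^{-1})V_C^\top x(0)+tV_CB_{1,1}^{-1}\varphi_1(-tB_{1,1}^{-1})V_C^\top G^{-1}u(0)+t^2V_CB_{1,1}^{-1}\varphi_2(-tB_{1,1}^{-1})V_C^\top G^{-1}u'(0).$$ The vectors $x(0),u(0),u'(0)$ are taken in the range of $C$. For $i=0,1,2$, with initial vector $v_0=x(0)$, $v_1=u(0)$, $v_2=u'(0)$ respectively, $W_m^{(i)}\in\mathbb{R}^{N\times m}$ and the upper Hessenberg matrix $H_m^{(i)}\in\mathbb{R}^{m\times m}$ are produced by the Arnoldi process for $S$ in the semi-inner product $x^\top Cy$: the columns of $W_m^{(i)}$ are a $C$-orthonormal basis (${W_m^{(i)}}^\top CW_m^{(i)}=I$) of $\mathrm{span}\{v_i,Sv_i,\dots,S^{m-1}v_i\}$ and $H_m^{(i)}={W_m^{(i)}}^\top CSW_m^{(i)}$. Then $$x_a(t)=W_m^{(0)}f(H_m^{(0)}){W_m^{(0)}}^\top Cx(0)+t\,W_m^{(1)}f_1(H_m^{(1)}){W_m^{(1)}}^\top Cu(0)+t^2\,W_m^{(2)}f_2(H_m^{(2)}){W_m^{(2)}}^\top Cu'(0).$$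
   Formalization: F_C is taken over ‖x‖_C=1; C≠0; the bound is for disks D(c1,ρ1) whose D(c0,ρ0) contains F_C(S) (one is shown to exist); in x_a and the bound, u(0),u'(0) are replaced by P_C G^{-1}u(0), P_C G^{-1}u'(0); |f_1|,|f_2| carry factors |t|,t^2, dropped if |t|≤1. *)

theory Defs
  imports "HOL-Analysis.Analysis"
begin

section \<open>Definiteness and the semi-inner product of \<open>C\<close>\<close>

text \<open>Positive definiteness does not include symmetry.\<close>

definition pos_def :: "real^'n^'n \<Rightarrow> bool" where
  "pos_def G \<longleftrightarrow> (\<forall>v. v \<noteq> 0 \<longrightarrow> v \<bullet> (G *v v) > 0)"

definition sym_pos_semidef :: "real^'n^'n \<Rightarrow> bool" where
  "sym_pos_semidef C \<longleftrightarrow> transpose C = C \<and> (\<forall>v. v \<bullet> (C *v v) \<ge> 0)"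

definition C_norm :: "real^'n^'n \<Rightarrow> real^'n \<Rightarrow> real" where
  "C_norm C x = sqrt (x \<bullet> (C *v x))"

text \<open>\<open>herm x y\<close> is \<open>x\<^sup>* y\<close>; the library inner product on \<open>complex^'n\<close> is only its real part.\<close>

definition herm :: "complex^'n \<Rightarrow> complex^'n \<Rightarrow> complex" where
  "herm x y = (\<Sum>i\<in>UNIV. cnj (x $ i) * y $ i)"

abbreviation cmat :: "real^'n^'m \<Rightarrow> complex^'n^'m" where
  "cmat A \<equiv> map_matrix complex_of_real A"

definition C_norm_complex :: "real^'n^'n \<Rightarrow> complex^'n \<Rightarrow> real" where
  "C_norm_complex C x = sqrt (Re (herm x (cmat C *v x)))"

text \<open>
  The \<open>C\<close>-numerical range is taken over the unit sphere \<open>\<parallel>x\<parallel>\<^sub>C = 1\<close>. Over the unit ball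
  \<open>\<parallel>x\<parallel>\<^sub>C \<le> 1\<close> it would contain \<open>0\<close> for every \<open>A\<close>, so that no disk around \<open>c\<close> of radius
  \<open>\<rho> < c\<close> could contain it.
\<close>

definition C_numrange :: "real^'n^'n \<Rightarrow> real^'n^'n \<Rightarrow> complex set" where
  "C_numrange C A = {herm x (cmat (C ** A) *v x) | x. C_norm_complex C x = 1}"

section \<open>The matrices \<open>B\<close>, \<open>B\<^sub>1\<^sub>1\<close> and \<open>S\<close>\<close>

definition reduced_eigen_decomp ::
    "real^'n^'n \<Rightarrow> real^'r^'n \<Rightarrow> real^'r^'r \<Rightarrow> bool" where
  "reduced_eigen_decomp C V C1 \<longleftrightarrow>
     CARD('r) = rank C \<and>
     C = V ** C1 ** transpose V \<and>
     transpose V ** V = mat 1 \<and>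
     range ((*v) V) = range ((*v) C) \<and>
     (\<forall>i j. i \<noteq> j \<longrightarrow> C1 $ i $ j = 0) \<and> (\<forall>i. C1 $ i $ i > 0)"

definition B_mat :: "real^'n^'n \<Rightarrow> real^'n^'n \<Rightarrow> real^'n^'n" where
  "B_mat C G = matrix_inv G ** C"

definition B11_mat :: "real^'r^'n \<Rightarrow> real^'n^'n \<Rightarrow> real^'n^'n \<Rightarrow> real^'r^'r" where
  "B11_mat V C G = transpose V ** matrix_inv G ** C ** V"

definition S_mat :: "real^'r^'n \<Rightarrow> real^'n^'n \<Rightarrow> real^'n^'n \<Rightarrow> real \<Rightarrow> real^'n^'n" where
  "S_mat V C G \<gamma> = (V ** transpose V) ** matrix_inv (C + \<gamma> *\<^sub>R G) ** C"

definition g_map :: "real \<Rightarrow> real \<Rightarrow> real" where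
  "g_map \<gamma> \<mu> = inverse (1 + \<gamma> * inverse \<mu>)"

definition S_center :: "real \<Rightarrow> real \<Rightarrow> real \<Rightarrow> real" where
  "S_center \<gamma> c1 \<rho>1 = (g_map \<gamma> (c1 - \<rho>1) + g_map \<gamma> (c1 + \<rho>1)) / 2"

definition S_radius :: "real \<Rightarrow> real \<Rightarrow> real \<Rightarrow> real" where
  "S_radius \<gamma> c1 \<rho>1 = (g_map \<gamma> (c1 + \<rho>1) - g_map \<gamma> (c1 - \<rho>1)) / 2"

section \<open>Phi-functions\<close>

text \<open>The singularity at \<open>0\<close> is removable, with value \<open>1/k!\<close> for the \<open>k\<close>-th function.\<close>

primrec phi :: "nat \<Rightarrow> complex \<Rightarrow> complex" where
  "phi 0 z = exp z"
| "phi (Suc k) z = (if z = 0 then 1 / fact (Suc k) else (phi k z - 1 / fact k) / z)"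

primrec mpow :: "real^'n^'n \<Rightarrow> nat \<Rightarrow> real^'n^'n" where
  "mpow A 0 = mat 1"
| "mpow A (Suc k) = A ** mpow A k"

definition mexp :: "real^'n^'n \<Rightarrow> real^'n^'n" where
  "mexp A = (\<Sum>k. (1 / fact k) *\<^sub>R mpow A k)"

text \<open>
  For \<open>k \<ge> 1\<close> this is the matrix function only at invertible \<open>Z\<close>. Below, \<open>Z = - t X\<close> with \<open>X\<close>
  invertible, so \<open>Z\<close> is singular only for \<open>t = 0\<close>, where \<open>mphi k\<close> is multiplied by \<open>t ^ k = 0\<close>.
\<close>

primrec mphi :: "nat \<Rightarrow> real^'n^'n \<Rightarrow> real^'n^'n" where
  "mphi 0 Z = mexp Z"
| "mphi (Suc k) Z = (mphi k Z - (1 / fact k) *\<^sub>R mat 1) ** matrix_inv Z"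

text \<open>\<open>g1_inv \<gamma> z\<close> is \<open>g\<^sub>1(z)\<^sup>-\<^sup>1\<close>.\<close>

definition g1_inv :: "real \<Rightarrow> complex \<Rightarrow> complex" where
  "g1_inv \<gamma> z = (inverse z - 1) / of_real \<gamma>"

definition f0 :: "real \<Rightarrow> real \<Rightarrow> complex \<Rightarrow> complex" where
  "f0 \<gamma> t z = phi 0 (- of_real t * g1_inv \<gamma> z)"

definition fk :: "nat \<Rightarrow> real \<Rightarrow> real \<Rightarrow> complex \<Rightarrow> complex" where
  "fk k \<gamma> t z = g1_inv \<gamma> z * phi k (- of_real t * g1_inv \<gamma> z)"

definition g1_inv_mat :: "real \<Rightarrow> real^'n^'n \<Rightarrow> real^'n^'n" where
  "g1_inv_mat \<gamma> M = (1 / \<gamma>) *\<^sub>R (matrix_inv M - mat 1)"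

definition f0_mat :: "real \<Rightarrow> real \<Rightarrow> real^'n^'n \<Rightarrow> real^'n^'n" where
  "f0_mat \<gamma> t M = mphi 0 (- t *\<^sub>R g1_inv_mat \<gamma> M)"

definition fk_mat :: "nat \<Rightarrow> real \<Rightarrow> real \<Rightarrow> real^'n^'n \<Rightarrow> real^'n^'n" where
  "fk_mat k \<gamma> t M = g1_inv_mat \<gamma> M ** mphi k (- t *\<^sub>R g1_inv_mat \<gamma> M)"

section \<open>Projected solution and Krylov approximation\<close>

text \<open>The projected solution of \<open>C x' + G x = b\<^sub>0 + s b\<^sub>1\<close> with initial value \<open>x\<^sub>0\<close>.\<close>

definition x_proj :: "real^'r^'n \<Rightarrow> real^'n^'n \<Rightarrow> real^'n^'n \<Rightarrow> real^'n \<Rightarrow> real^'n \<Rightarrow> real^'n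
    \<Rightarrow> real \<Rightarrow> real^'n" where
  "x_proj V C G x0 b0 b1 t =
     (let X = matrix_inv (B11_mat V C G) in
        (V ** mexp (- t *\<^sub>R X) ** transpose V) *v x0
        + t *\<^sub>R ((V ** X ** mphi 1 (- t *\<^sub>R X) ** transpose V ** matrix_inv G) *v b0)
        + t\<^sup>2 *\<^sub>R ((V ** X ** mphi 2 (- t *\<^sub>R X) ** transpose V ** matrix_inv G) *v b1))"

text \<open>Entries below the first subdiagonal vanish; the index type is any finite linear order.\<close>

definition upper_hessenberg :: "real^('m::{finite,linorder})^('m::{finite,linorder}) \<Rightarrow> bool" where
  "upper_hessenberg H \<longleftrightarrow> (\<forall>i j. (\<exists>k. j < k \<and> k < i) \<longrightarrow> H $ i $ j = 0)"

text \<open>Linear independence of the columns of \<open>W\<close> follows from their \<open>C\<close>-orthonormality.\<close>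

definition arnoldi :: "real^'n^'n \<Rightarrow> real^'n^'n \<Rightarrow> real^'n
    \<Rightarrow> real^('m::{finite,linorder})^'n \<Rightarrow> real^('m::{finite,linorder})^('m::{finite,linorder}) \<Rightarrow> bool" where
  "arnoldi C S v W H \<longleftrightarrow>
     transpose W ** C ** W = mat 1 \<and>
     span (columns W) = span {mpow S j *v v | j. j < CARD('m)} \<and>
     H = transpose W ** C ** S ** W \<and>
     upper_hessenberg H"

definition x_krylov :: "real^'n^'n \<Rightarrow> real \<Rightarrow>
    real^'m^'n \<Rightarrow> real^'m^'m \<Rightarrow> real^'m^'n \<Rightarrow> real^'m^'m \<Rightarrow> real^'m^'n \<Rightarrow> real^'m^'m \<Rightarrow>
    real^'n \<Rightarrow> real^'n \<Rightarrow> real^'n \<Rightarrow> real \<Rightarrow> real^'n" where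
  "x_krylov C \<gamma> W0 H0 W1 H1 W2 H2 x0 u0 u1 t =
     (W0 ** f0_mat \<gamma> t H0 ** transpose W0 ** C) *v x0
     + t *\<^sub>R ((W1 ** fk_mat 1 \<gamma> t H1 ** transpose W1 ** C) *v u0)
     + t\<^sup>2 *\<^sub>R ((W2 ** fk_mat 2 \<gamma> t H2 ** transpose W2 ** C) *v u1)"

end

theory Submission
  imports Defs "HOL-Complex_Analysis.Complex_Analysis"
begin

text \<open>
  The idea is to expand the three functions \<open>f\<close>, \<open>f\<^sub>1\<close>, \<open>f\<^sub>2\<close> in powers of \<open>z - c\<^sub>0\<close>. A Krylov
  approximation of dimension \<open>m\<close> is exact for polynomials of degree less than \<open>m\<close>
  (\<open>krylov_exact\<close>), so only the tails of the power series contribute to the error. For a matrix whose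
  numerical range lies in the disk around \<open>c\<^sub>0\<close> of radius \<open>\<rho>\<^sub>0\<close>, the \<open>j\<close>-th power of the matrix
  shifted by \<open>c\<^sub>0\<close> has norm at most \<open>2 \<rho>\<^sub>0\<^sup>j\<close>, by Berger's power inequality and the bound of the norm
  by twice the numerical radius (\<open>norm_mpow_le\<close>). This applies to \<open>S\<close> and to its compressions \<open>H\<close>, so
  the \<open>j\<close>-th terms contribute at most \<open>4 \<rho>\<^sub>0\<^sup>j\<close> times the sum of the moduli of the \<open>j\<close>-th
  coefficients, weighted by the norms of the initial vectors and the powers of \<open>|t|\<close>. By Cauchy's
  estimate on the circle of radius \<open>r\<close>, applied to all three functions at once
  (\<open>cauchy_estimate_sum\<close>), this sum is at most \<open>M / r\<^sup>j\<close>, where \<open>M\<close> is the supremum over the circle. The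
  geometric series from \<open>j = m\<close> on gives \<open>4 M r / (r - \<rho>\<^sub>0) \<cdot> (\<rho>\<^sub>0 / r)\<^sup>m\<close>, and
  \<open>r < c\<^sub>0 < 1\<close>.

  To reduce the statement to Euclidean space, factor \<open>C = U U\<^sup>T\<close> with \<open>U = V C\<^sub>1\<^sup>1\<^sup>/\<^sup>2\<close>. Then
  \<open>\<parallel>x\<parallel>\<^sub>C = |U\<^sup>T x|\<close>, and \<open>U\<^sup>T\<close> carries \<open>B\<close> to \<open>D = U\<^sup>T G\<^sup>-\<^sup>1 U\<close>, which is positive definite, and
  \<open>S\<close> to \<open>E = U\<^sup>T (C + \<gamma> G)\<^sup>-\<^sup>1 U\<close>. These satisfy \<open>E (D + \<gamma>) = D\<close>, that is
  \<open>g\<^sub>1(E)\<^sup>-\<^sup>1 = D\<^sup>-\<^sup>1\<close>, so the coordinates of the projected solution are given by \<open>f\<close>, \<open>f\<^sub>1\<close>, \<open>f\<^sub>2\<close> at \<open>E\<close>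
  (\<open>x_proj_coordinates\<close>). Two facts connect the power series with the matrix functions
  of the statement, which are defined by the exponential series and by division (\<open>f0_mat_eq\<close>,
  \<open>fk_mat_eq\<close>): \<open>mat_fun\<close> is continuous for uniform convergence on circles, and it respects
  multiplication by \<open>g\<^sub>1\<^sup>-\<^sup>1\<close>.

  For the existence of the disks it does not suffice to enclose the numerical range of \<open>D\<close>, since the
  Moebius map from \<open>D\<close> to \<open>E\<close> need not carry such a disk to a disk that contains the numerical range of
  \<open>E\<close>. It does carry operator norm disks to each other (\<open>mobius_disk\<close>), and \<open>D\<close> has an operator
  norm disk with \<open>0\<close> outside (\<open>pos_def_in_disk\<close>).
\<close>

(* Products with transposed matrices are kept in the form transpose A *v x, to which associativity applies. *)
declare transpose_matrix_vector [simp del]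

(* The dollar sign denotes entries of vectors and matrices only. *)
no_notation fps_nth (infixl \<open>$\<close> 75)

section \<open>Powers of a matrix with bounded numerical radius\<close>

lemma herm_sum_left: "herm (\<Sum>i\<in>I. f i) y = (\<Sum>i\<in>I. herm (f i) y)"
  unfolding herm_def by (simp add: sum_distrib_right) (rule sum.swap)

lemma herm_diff_right: "herm x (y - z) = herm x y - herm x z"
  unfolding herm_def by (simp add: algebra_simps sum_subtractf)

lemma herm_scale_right: "herm x (c *s y) = c * herm x y"
  unfolding herm_def by (simp add: sum_distrib_left mult_ac)

lemma herm_self: "herm x x = of_real ((norm x)\<^sup>2)"
proof -
  have "(norm x)\<^sup>2 = (\<Sum>i\<in>UNIV. (cmod (x $ i))\<^sup>2)"
    by (simp add: norm_vec_def L2_set_def sum_nonneg)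
  moreover have "cnj z * z = of_real ((cmod z)\<^sup>2)" for z
    by (metis complex_norm_square mult.commute)
  ultimately show ?thesis unfolding herm_def by simp
qed

text \<open>
  Orthogonality of the characters of \<open>\<int>/n\<close>, for powers of the \<open>n\<close>-th roots of unity.
\<close>

lemma sum_cis_multiples:
  assumes "l < n"
  shows "(\<Sum>j<n. cis (2 * pi * real j / real n) ^ l) = (if l = 0 then of_nat n else 0)"
proof (cases "l = 0")
  case False
  define q where "q = cis (2 * pi * real l / real n)"
  have n: "n > 0" using assms by simp
  have eq: "cis (2 * pi * real j / real n) ^ l = q ^ j" for j
    by (simp add: q_def Complex.DeMoivre mult_ac)
  have "q \<noteq> 1"
  proof
    assume "q = 1"
    then have "cos (2 * pi * real l / real n) = 1" by (simp add: q_def complex_eq_iff)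
    then obtain m :: int where m: "2 * pi * real l / real n = of_int m * 2 * pi"
      using cos_one_2pi_int by auto
    then have "real l = of_int m * real n" using n by (simp add: field_simps)
    then have "int l = m * int n" by (metis of_int_eq_iff of_int_mult of_int_of_nat_eq)
    then have "n dvd l" by (metis dvd_triv_right int_dvd_int_iff)
    then show False using False assms by (auto dest: dvd_imp_le)
  qed
  moreover have "q ^ n = 1" using n by (simp add: q_def Complex.DeMoivre cis_multiple_2pi)
  ultimately have "(\<Sum>j<n. q ^ j) = 0" by (simp add: geometric_sum)
  then show ?thesis using False eq by simp
qed simp

text \<open>
  Pearcy's argument. With \<open>\<omega>\<close> running over the \<open>n\<close>-th roots of unity, \<open>x\<close> is the sum of the vectors
  \<open>X\<^sub>\<omega> = (1/n) \<Sum>\<^sub>l \<omega>\<^sup>l f\<^sup>l x\<close>, and \<open>(1 - \<omega> f) X\<^sub>\<omega> = (x - f\<^sup>n x) / n\<close> for each \<open>\<omega>\<close> by telescoping. Hence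
  \<open>x\<^sup>* (x - f\<^sup>n x)\<close> is a sum of terms \<open>n X\<^sub>\<omega>\<^sup>* (1 - \<omega> f) X\<^sub>\<omega>\<close>, each with nonnegative real part.
\<close>

lemma power_inequality_Re:
  fixes f :: "complex^'n \<Rightarrow> complex^'n"
  assumes lin: "Vector_Spaces.linear (*s) (*s) f"
    and bound: "\<And>x. cmod (herm x (f x)) \<le> (norm x)\<^sup>2"
    and n: "n > 0"
  shows "Re (herm x ((f ^^ n) x)) \<le> (norm x)\<^sup>2"
proof -
  interpret f: Vector_Spaces.linear "(*s)" "(*s)" f by (rule lin)
  define \<omega> where "\<omega> j = cis (2 * pi * real j / real n)" for j
  have \<omega>n: "\<omega> j ^ n = 1" for j using n
    by (simp add: \<omega>_def Complex.DeMoivre cis_multiple_2pi)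
  define X where "X j = (\<Sum>l<n. (\<omega> j ^ l / of_nat n) *s (f ^^ l) x)" for j
  have sumX: "(\<Sum>j<n. X j) = x"
  proof -
    have "(\<Sum>j<n. X j) = (\<Sum>l<n. \<Sum>j<n. (\<omega> j ^ l / of_nat n) *s (f ^^ l) x)"
      unfolding X_def by (rule sum.swap)
    also have "\<dots> = (\<Sum>l<n. ((\<Sum>j<n. \<omega> j ^ l) / of_nat n) *s (f ^^ l) x)"
      by (simp add: vector_sub_rdistrib sum_divide_distrib vec.scale_sum_left)
    also have "\<dots> = (\<Sum>l<n. if l = 0 then x else 0)"
    proof (rule sum.cong)
      fix l assume "l \<in> {..<n}"
      then have "(\<Sum>j<n. \<omega> j ^ l) = (if l = 0 then of_nat n else 0)"
        using sum_cis_multiples[of l n] by (simp add: \<omega>_def)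
      then show "((\<Sum>j<n. \<omega> j ^ l) / of_nat n) *s (f ^^ l) x = (if l = 0 then x else 0)"
        using n by simp
    qed simp
    also have "\<dots> = x" using n by simp
    finally show ?thesis .
  qed
  have step: "x - (f ^^ n) x = of_nat n *s (X j - \<omega> j *s f (X j))" for j
  proof -
    have "\<omega> j *s f (X j) = (\<Sum>l<n. (\<omega> j ^ Suc l / of_nat n) *s (f ^^ Suc l) x)"
      unfolding X_def by (simp add: f.sum f.scale vec.scale_sum_right vector_smult_assoc)
    then have "X j - \<omega> j *s f (X j) =
      (\<Sum>l<n. (\<omega> j ^ l / of_nat n) *s (f ^^ l) x - (\<omega> j ^ Suc l / of_nat n) *s (f ^^ Suc l) x)"
      unfolding X_def by (simp only: sum_subtractf)
    also have "\<dots> = (\<omega> j ^ 0 / of_nat n) *s (f ^^ 0) x - (\<omega> j ^ n / of_nat n) *s (f ^^ n) x"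
      by (rule sum_lessThan_telescope')
    finally show ?thesis using n \<omega>n by (simp add: vec.scale_right_diff_distrib vector_smult_assoc)
  qed
  have "herm x (x - (f ^^ n) x) = (\<Sum>j<n. herm (X j) (x - (f ^^ n) x))"
    by (subst (1) sumX[symmetric]) (rule herm_sum_left)
  also have "\<dots> = (\<Sum>j<n. of_nat n * (of_real ((norm (X j))\<^sup>2) - \<omega> j * herm (X j) (f (X j))))"
  proof (rule sum.cong)
    fix j
    show "herm (X j) (x - (f ^^ n) x) = of_nat n * (of_real ((norm (X j))\<^sup>2) - \<omega> j * herm (X j) (f (X j)))"
      by (subst step[of j]) (simp add: herm_diff_right herm_scale_right herm_self right_diff_distrib mult.assoc)
  qed simp
  finally have eq: "herm x (x - (f ^^ n) x) =
     (\<Sum>j<n. of_nat n * (of_real ((norm (X j))\<^sup>2) - \<omega> j * herm (X j) (f (X j))))" .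
  have "0 \<le> Re (of_nat n * (of_real ((norm (X j))\<^sup>2) - \<omega> j * herm (X j) (f (X j))))" for j
  proof -
    have "Re (\<omega> j * herm (X j) (f (X j))) \<le> cmod (\<omega> j * herm (X j) (f (X j)))"
      by (rule complex_Re_le_cmod)
    also have "\<dots> \<le> (norm (X j))\<^sup>2" using bound by (simp add: norm_mult \<omega>_def)
    finally have "0 \<le> real n * ((norm (X j))\<^sup>2 - Re (\<omega> j * herm (X j) (f (X j))))" by simp
    then show ?thesis by simp
  qed
  then have "0 \<le> Re (herm x (x - (f ^^ n) x))" unfolding eq Re_sum by (rule sum_nonneg)
  then show ?thesis by (simp add: herm_diff_right herm_self)
qed

text \<open>
  Berger's power inequality for the numerical radius.
\<close>

lemma power_inequality:
  fixes f :: "complex^'n \<Rightarrow> complex^'n"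
  assumes lin: "Vector_Spaces.linear (*s) (*s) f"
    and bound: "\<And>x. cmod (herm x (f x)) \<le> \<rho> * (norm x)\<^sup>2"
    and \<rho>: "\<rho> > 0"
  shows "cmod (herm x ((f ^^ n) x)) \<le> \<rho> ^ n * (norm x)\<^sup>2"
proof (cases "n = 0")
  case True
  then show ?thesis by (simp add: herm_self norm_power)
next
  case False
  interpret f: Vector_Spaces.linear "(*s)" "(*s)" f by (rule lin)
  define h where "h = herm x ((f ^^ n) x)"
  obtain u where u: "cmod u = 1" "u * h = of_real (cmod h)"
  proof (cases "h = 0")
    case True then show ?thesis using that[of 1] by simp
  next
    case False
    then show ?thesis using that[of "of_real (cmod h) / h"] by (simp add: norm_divide)
  qed
  \<comment> \<open>\<open>\<zeta>\<close> is an \<open>n\<close>-th root of the phase that makes \<open>h\<close> real: rotating \<open>f\<close> by \<open>\<zeta>\<close> reduces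
    the modulus bound to the bound on the real part.\<close>
  define \<zeta> where "\<zeta> = cis (Arg u / real n)"
  have \<zeta>: "\<zeta> ^ n = u" "cmod \<zeta> = 1"
  proof -
    have "\<zeta> ^ n = cis (Arg u)" using False by (simp add: \<zeta>_def Complex.DeMoivre)
    also have "\<dots> = u" using u(1) cis_Arg[of u] by (cases "u = 0") (auto simp: sgn_eq)
    finally show "\<zeta> ^ n = u" .
  qed (simp add: \<zeta>_def)
  define c where "c = \<zeta> / of_real \<rho>"
  define g where "g y = c *s f y" for y
  have pow: "(g ^^ k) y = c ^ k *s (f ^^ k) y" for k y
    by (induction k) (simp_all add: g_def f.scale vector_smult_assoc mult_ac)
  have ling: "Vector_Spaces.linear (*s) (*s) g" unfolding g_def
    using vec.module_hom_axioms f.linear_axioms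
    by (simp add: vec.linear_compose_scale_right)
  have "cmod (herm y (g y)) \<le> (norm y)\<^sup>2" for y
    using bound[of y] \<rho> by (simp add: g_def herm_scale_right norm_mult c_def norm_divide \<zeta> field_simps)
  from power_inequality_Re[OF ling this] False have "Re (herm x ((g ^^ n) x)) \<le> (norm x)\<^sup>2" by simp
  also have "herm x ((g ^^ n) x) = of_real (cmod h / \<rho> ^ n)"
    by (simp add: pow herm_scale_right c_def power_divide \<zeta> h_def[symmetric] u(2))
  finally show ?thesis using \<rho> by (simp add: h_def field_simps)
qed

lemma cmat_mult: "cmat (A ** B) = cmat A ** cmat B"
  by (simp add: vec_eq_iff matrix_matrix_mult_def)

lemma cmat_mat_1: "cmat (mat 1) = mat 1"
  by (simp add: vec_eq_iff mat_def)

lemma cmat_mpow: "cmat (mpow A n) *v x = ((*v) (cmat A) ^^ n) x"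
  by (induction n) (simp_all add: cmat_mult cmat_mat_1 flip: matrix_vector_mul_assoc)

definition num_radius_le :: "real^'n^'n \<Rightarrow> real \<Rightarrow> bool" where
  "num_radius_le A \<rho> \<longleftrightarrow> (\<forall>w. cmod (herm w (cmat A *v w)) \<le> \<rho> * (norm w)\<^sup>2)"

lemma num_radius_le_mpow:
  assumes "num_radius_le A \<rho>" "\<rho> > 0"
  shows "num_radius_le (mpow A n) (\<rho> ^ n)"
  using power_inequality[OF matrix_vector_mul_linear_gen, of "cmat A" \<rho>] assms
  by (simp add: num_radius_le_def cmat_mpow)

text \<open>
  A complex vector given by its real and imaginary parts. A real matrix acts on the two parts separately.
\<close>

definition cvec :: "real^'n \<Rightarrow> real^'n \<Rightarrow> complex^'n" where
  "cvec a b = (\<chi> i. Complex (a $ i) (b $ i))"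

lemma cvec_surj: obtains a b where "w = cvec a b"
  by (rule that[of "\<chi> i. Re (w $ i)" "\<chi> i. Im (w $ i)"]) (simp add: cvec_def vec_eq_iff)

lemma norm_cvec: "(norm (cvec a b))\<^sup>2 = (norm a)\<^sup>2 + (norm b)\<^sup>2"
  by (simp add: norm_vec_def L2_set_def sum_nonneg cvec_def cmod_power2 sum.distrib)

lemma cmat_cvec: "cmat A *v cvec a b = cvec (A *v a) (A *v b)"
  by (simp add: vec_eq_iff matrix_vector_mult_def cvec_def complex_eq_iff)

lemma herm_cvec: "herm (cvec a b) (cvec c d) = Complex (a \<bullet> c + b \<bullet> d) (a \<bullet> d - b \<bullet> c)"
  by (simp add: herm_def cvec_def inner_vec_def complex_eq_iff sum.distrib sum_subtractf)

text \<open>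
  A matrix norm is at most twice the numerical radius. For a real matrix, the symmetric part of
  \<open>(x, y) \<mapsto> y \<bullet> T x\<close> is controlled by polarization over real vectors; the antisymmetric part is the
  imaginary part of the form at \<open>x + i y\<close>, which is where the complex numerical range is needed.
\<close>

lemma num_radius_le_imp_norm:
  assumes "num_radius_le T c"
  shows "norm (T *v x) \<le> 2 * c * norm x"
proof (cases "x = 0 \<or> T *v x = 0")
  case True
  have "0 \<le> c * norm x" if "x \<noteq> 0"
  proof -
    have "0 \<le> cmod (herm (cvec x 0) (cmat T *v cvec x 0))" by simp
    also have "\<dots> \<le> c * (norm x)\<^sup>2"
      using assms unfolding num_radius_le_def by (metis norm_cvec norm_zero power_zero_numeral add_0_right)
    finally show ?thesis using that by (simp add: zero_le_mult_iff)
  qed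
  then show ?thesis using True by (cases "x = 0") auto
next
  case False
  have bound: "cmod (Complex (a \<bullet> (T *v a) + b \<bullet> (T *v b)) (a \<bullet> (T *v b) - b \<bullet> (T *v a)))
      \<le> c * ((norm a)\<^sup>2 + (norm b)\<^sup>2)" for a b
    using assms unfolding num_radius_le_def by (metis norm_cvec herm_cvec cmat_cvec)
  have quad: "\<bar>a \<bullet> (T *v a)\<bar> \<le> c * (norm a)\<^sup>2" for a
    using bound[of a 0] abs_Re_le_cmod order_trans by fastforce
  have skew: "\<bar>a \<bullet> (T *v b) - b \<bullet> (T *v a)\<bar> \<le> c * ((norm a)\<^sup>2 + (norm b)\<^sup>2)" for a b
    using bound[of a b] abs_Im_le_cmod order_trans by fastforce
  define y where "y = (norm x / norm (T *v x)) *\<^sub>R (T *v x)"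
  have y: "norm y = norm x" "y \<bullet> (T *v x) = norm x * norm (T *v x)"
    using False by (auto simp: y_def dot_square_norm power2_eq_square)
  have "2 * (x \<bullet> (T *v y) + y \<bullet> (T *v x)) =
      (x + y) \<bullet> (T *v (x + y)) - (x - y) \<bullet> (T *v (x - y))"
    by (simp add: algebra_simps inner_left_distrib inner_right_distrib inner_diff_left inner_diff_right)
  also have "\<dots> \<le> c * (norm (x + y))\<^sup>2 + c * (norm (x - y))\<^sup>2"
    using quad[of "x + y"] quad[of "x - y"] by linarith
  also have "\<dots> = 2 * c * ((norm x)\<^sup>2 + (norm y)\<^sup>2)"
    by (simp add: power2_norm_eq_inner algebra_simps inner_left_distrib inner_right_distrib
        inner_diff_left inner_diff_right inner_commute)
  finally have "norm x * norm (T *v x) \<le> norm x * (2 * c * norm x)"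
    using skew[of x y] y by (simp add: power2_eq_square algebra_simps)
  then show ?thesis using False by simp
qed

text \<open>
  The factor 2 does not grow with \<open>n\<close>, which a bound on the norm of \<open>A\<close> itself would not give. It
  is used once for the full matrix and once for its compression, hence the constant 4 in the error
  bound.
\<close>

corollary norm_mpow_le:
  assumes "num_radius_le A \<rho>" "\<rho> > 0"
  shows "norm (mpow A n *v x) \<le> 2 * \<rho> ^ n * norm x"
  using num_radius_le_imp_norm[OF num_radius_le_mpow[OF assms]] .

section \<open>Matrix algebra\<close>

lemma bounded_bilinear_matrix_mult:
  "bounded_bilinear ((**) :: real^'m^'n \<Rightarrow> real^'k^'m \<Rightarrow> real^'k^'n)"
  unfolding bilinear_conv_bounded_bilinear[symmetric] bilinear_def
  by (auto intro!: linearI simp: matrix_matrix_mult_def vec_eq_iff algebra_simps sum.distrib sum_distrib_left)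

interpretation matmul: bounded_bilinear "(**) :: real^'m^'n \<Rightarrow> real^'k^'m \<Rightarrow> real^'k^'n"
  by (rule bounded_bilinear_matrix_mult)

lemma
  assumes "invertible (A :: real^'n^'n)"
  shows matrix_inv_right: "A ** matrix_inv A = mat 1" and matrix_inv_left: "matrix_inv A ** A = mat 1"
  using assms unfolding invertible_def matrix_inv_def by (metis (mono_tags, lifting) someI_ex)+

lemma invertibleI:
  assumes "(A :: real^'n^'n) ** B = mat 1"
  shows "invertible A" and "matrix_inv A = B"
proof -
  have "B ** A = mat 1" using assms matrix_left_right_inverse by blast
  then show *: "invertible A" using assms unfolding invertible_def by blast
  show "matrix_inv A = B"
    by (metis * assms matrix_inv_left matrix_mul_assoc matrix_mul_lid matrix_mul_rid)
qed

lemma invertible_if_ker: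
  assumes "\<And>x. (A :: real^'n^'n) *v x = 0 \<Longrightarrow> x = 0"
  shows "invertible A"
  by (metis assms invertible_left_inverse matrix_left_invertible_ker)

lemma mpow_commute: "mpow A n ** A = A ** mpow A n"
  by (induction n) (simp_all flip: matrix_mul_assoc)

section \<open>The phi-functions are entire\<close>

text \<open>
  This single power series covers the removable singularity at \<open>0\<close> and shows that the phi-functions are entire.
\<close>

lemma phi_sums: "(\<lambda>n. z ^ n / fact (n + k)) sums phi k z"
proof (induction k)
  case 0
  then show ?case using exp_converges[of z] by (simp add: scaleR_conv_of_real field_simps)
next
  case (Suc k)
  show ?case
  proof (cases "z = 0")
    case True
    then show ?thesis using powser_sums_zero[of "\<lambda>n. 1 / fact (n + Suc k) :: complex"] by simp
  next
    case False
    have "(\<lambda>n. z ^ Suc n / fact (Suc n + k)) sums (phi k z - 1 / fact k)"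
      using Suc by (subst sums_Suc_iff) simp
    from sums_divide[OF this, of z] show ?thesis using False by simp
  qed
qed

lemma phi_holomorphic: "phi k holomorphic_on UNIV"
proof -
  have "phi k holomorphic_on ball 0 r" for r
    by (rule power_series_holomorphic[where a = "\<lambda>n. 1 / fact (n + k)"]) (simp add: phi_sums)
  then have "phi k holomorphic_on (\<Union>r. ball 0 r)"
    by (intro holomorphic_on_UN_open) auto
  moreover have "(\<Union>r. ball (0::complex) r) = UNIV"
    by (auto intro: gt_ex)
  ultimately show ?thesis by simp
qed

text \<open>
  Unlike the recursion with a quotient, this form also holds at \<open>z = 0\<close> and carries over to matrices.
\<close>

lemma phi_Suc_mult: "phi (Suc k) z * z = phi k z - 1 / fact k"
proof (cases "z = 0")
  case True
  have "phi k 0 = 1 / fact k" by (cases k) auto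
  then show ?thesis using True by simp
qed simp

section \<open>Power series in a real matrix\<close>

abbreviation taylor :: "(complex \<Rightarrow> complex) \<Rightarrow> nat \<Rightarrow> complex" where
  "taylor h j \<equiv> fps_nth (fps_expansion h 0) j"

lemma cauchy_estimate:
  assumes h: "h holomorphic_on ball 0 R" and r: "0 < r" "r < R"
    and B: "\<And>z. cmod z = r \<Longrightarrow> cmod (h z) \<le> B"
  shows "cmod (taylor h j) \<le> B / r ^ j"
proof -
  have "cball 0 r \<subseteq> ball (0::complex) R" using r by auto
  then have "h holomorphic_on ball 0 r" "continuous_on (cball 0 r) h"
    using h holomorphic_on_imp_continuous_on holomorphic_on_subset ball_subset_cball by blast+
  from Cauchy_inequality[OF this r(1), of B j] B
  have "cmod ((deriv ^^ j) h 0) \<le> fact j * B / r ^ j" by simp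
  then show ?thesis by (simp add: fps_expansion_def norm_divide field_simps)
qed

lemma holomorphic_bounded_on_circle:
  assumes "h holomorphic_on ball 0 R" "0 < r" "r < R"
  obtains B where "\<And>z. cmod z = r \<Longrightarrow> cmod (h z) \<le> B"
proof -
  have "sphere 0 r \<subseteq> ball (0::complex) R" using assms by auto
  then have "continuous_on (sphere 0 r) h"
    using holomorphic_on_imp_continuous_on[OF assms(1)] continuous_on_subset by blast
  then have "compact (h ` sphere 0 r)" by (intro compact_continuous_image compact_sphere)
  then obtain B where "\<forall>x\<in>h ` sphere 0 r. norm x \<le> B"
    using compact_imp_bounded bounded_iff by blast
  then show thesis using that[of B] by simp
qed

text \<open>
  Only the real parts of the Taylor coefficients at \<open>0\<close> enter, so that \<open>mat_fun h A\<close> is a real matrix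
  for every holomorphic \<open>h\<close>; for functions that are real on the real line this is the usual \<open>h(A)\<close>. The
  map \<open>h \<mapsto> mat_fun h A\<close> is real linear, and it is compatible with multiplication by functions that are
  real on the real line, which is all that is used below. Expansions around another real centre
  \<open>c\<close> are obtained by taking \<open>A = M - c I\<close> and \<open>h(z) = f(c + z)\<close>.
\<close>

definition mat_fun :: "(complex \<Rightarrow> complex) \<Rightarrow> real^'n^'n \<Rightarrow> real^'n^'n" where
  "mat_fun h A = (\<Sum>j. Re (taylor h j) *\<^sub>R mpow A j)"

definition power_growth :: "real^'n^'n \<Rightarrow> real \<Rightarrow> bool" where
  "power_growth A \<rho> \<longleftrightarrow> (\<exists>K. \<forall>j. norm (mpow A j) \<le> K * \<rho> ^ j)"

text \<open>
  \<open>Z\<close> is the value \<open>u(A)\<close>, expressed by how it acts in products. This makes powers, the exponential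
  and the phi-functions of \<open>u\<close> available without a product formula for two arbitrary power series.
\<close>

definition realizes :: "real^'n^'n \<Rightarrow> real \<Rightarrow> (complex \<Rightarrow> complex) \<Rightarrow> real^'n^'n \<Rightarrow> bool" where
  "realizes A R u Z \<longleftrightarrow> u holomorphic_on ball 0 R \<and>
     (\<forall>h. h holomorphic_on ball 0 R \<longrightarrow> mat_fun (\<lambda>z. u z * h z) A = mat_fun h A ** Z)"

context
  fixes A :: "real^'n^'n" and \<rho> R :: real
  assumes growth: "power_growth A \<rho>" and \<rho>: "0 \<le> \<rho>" "\<rho> < R"
begin

text \<open>
  The constant is independent of \<open>h\<close>: it makes \<open>mat_fun\<close> continuous for uniform convergence
  on a circle of radius \<open>r\<close> between \<open>\<rho>\<close> and \<open>R\<close>.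
\<close>

lemma mat_fun_majorant:
  assumes r: "\<rho> < r" "r < R"
  obtains K where "K \<ge> 0"
    "\<And>h B j. h holomorphic_on ball 0 R \<Longrightarrow> (\<And>z. cmod z = r \<Longrightarrow> cmod (h z) \<le> B) \<Longrightarrow>
      norm (Re (taylor h j) *\<^sub>R mpow A j) \<le> K * B * (\<rho> / r) ^ j"
proof -
  from growth obtain K where K: "norm (mpow A j) \<le> K * \<rho> ^ j" for j
    unfolding power_growth_def by blast
  have K0: "K \<ge> 0" using order_trans[OF norm_ge_zero K[of 0]] by simp
  show thesis
  proof (rule that[OF K0])
    fix h B j
    assume h: "h holomorphic_on ball 0 R" "\<And>z. cmod z = r \<Longrightarrow> cmod (h z) \<le> B"
    have "r > 0" using r \<rho> by simp
    have le: "\<bar>Re (taylor h j)\<bar> \<le> B / r ^ j"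
      using cauchy_estimate[OF h(1) \<open>r > 0\<close> r(2) h(2), of j] abs_Re_le_cmod[of "taylor h j"] by linarith
    have "0 \<le> B / r ^ j" using le abs_ge_zero order_trans by blast
    with le have "\<bar>Re (taylor h j)\<bar> * norm (mpow A j) \<le> (B / r ^ j) * (K * \<rho> ^ j)"
      by (intro mult_mono K) auto
    then show "norm (Re (taylor h j) *\<^sub>R mpow A j) \<le> K * B * (\<rho> / r) ^ j"
      by (simp add: power_divide mult_ac)
  qed
qed

lemma summable_mat_fun:
  assumes "h holomorphic_on ball 0 R"
  shows "summable (\<lambda>j. Re (taylor h j) *\<^sub>R mpow A j)"
proof -
  obtain r where r: "\<rho> < r" "r < R" using dense \<rho>(2) by blast
  obtain B where B: "\<And>z. cmod z = r \<Longrightarrow> cmod (h z) \<le> B"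
    using holomorphic_bounded_on_circle[OF assms _ r(2)] r \<rho> by force
  obtain K where "\<And>h B j. h holomorphic_on ball 0 R \<Longrightarrow> (\<And>z. cmod z = r \<Longrightarrow> cmod (h z) \<le> B) \<Longrightarrow>
      norm (Re (taylor h j) *\<^sub>R mpow A j) \<le> K * B * (\<rho> / r) ^ j"
    using mat_fun_majorant[OF r] by metis
  note K = this[OF assms B]
  have "summable (\<lambda>j. K * B * (\<rho> / r) ^ j)"
    using r \<rho> by (intro summable_mult summable_geometric) auto
  then show ?thesis by (rule summable_comparison_test'[of _ 0]) (use K in auto)
qed

lemma mat_fun_bound:
  assumes r: "\<rho> < r" "r < R"
  obtains K where "\<And>h B. h holomorphic_on ball 0 R \<Longrightarrow> (\<And>z. cmod z = r \<Longrightarrow> cmod (h z) \<le> B) \<Longrightarrow>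
      norm (mat_fun h A) \<le> K * B"
proof -
  obtain K where K: "\<And>h B j. h holomorphic_on ball 0 R \<Longrightarrow> (\<And>z. cmod z = r \<Longrightarrow> cmod (h z) \<le> B) \<Longrightarrow>
      norm (Re (taylor h j) *\<^sub>R mpow A j) \<le> K * B * (\<rho> / r) ^ j"
    using mat_fun_majorant[OF r] by metis
  have q: "norm (\<rho> / r) < 1" using r \<rho> by auto
  show thesis
  proof (rule that)
    fix h B assume h: "h holomorphic_on ball 0 R" "\<And>z. cmod z = r \<Longrightarrow> cmod (h z) \<le> B"
    have "summable (\<lambda>j. K * B * (\<rho> / r) ^ j)"
      using q by (intro summable_mult summable_geometric)
    with K[OF h] have "norm (mat_fun h A) \<le> (\<Sum>j. K * B * (\<rho> / r) ^ j)"
      unfolding mat_fun_def by (intro norm_suminf_le)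
    also have "\<dots> = K / (1 - \<rho> / r) * B"
      using suminf_mult[OF summable_geometric[OF q], of "K * B"] by (simp add: suminf_geometric[OF q])
    finally show "norm (mat_fun h A) \<le> K / (1 - \<rho> / r) * B" .
  qed
qed

lemma has_taylor_expansion:
  assumes "h holomorphic_on ball 0 R"
  shows "h has_fps_expansion fps_expansion h 0"
  using assms \<rho> by (intro has_fps_expansion_fps_expansion[of "ball 0 R"]) auto

lemma mat_fun_cong:
  assumes "\<And>z. cmod z < R \<Longrightarrow> h z = k z"
  shows "mat_fun h A = mat_fun k A"
proof -
  have "eventually (\<lambda>z. z \<in> ball 0 R) (nhds (0::complex))"
    using \<rho> by (intro eventually_nhds_in_open) auto
  then have "eventually (\<lambda>z. h z = k z) (nhds 0)"
    by (rule eventually_mono) (use assms in auto)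
  then have "fps_expansion h 0 = fps_expansion k 0" by (intro fps_expansion_cong) auto
  then show ?thesis by (simp add: mat_fun_def)
qed

lemma mat_fun_diff:
  assumes "h holomorphic_on ball 0 R" "k holomorphic_on ball 0 R"
  shows "mat_fun (\<lambda>z. h z - k z) A = mat_fun h A - mat_fun k A"
proof -
  have "fps_expansion (\<lambda>z. h z - k z) 0 = fps_expansion h 0 - fps_expansion k 0"
    by (intro fps_expansion_eqI has_fps_expansion_diff has_taylor_expansion assms)
  then show ?thesis unfolding mat_fun_def
    using suminf_diff[OF summable_mat_fun[OF assms(1)] summable_mat_fun[OF assms(2)]]
    by (simp add: scaleR_diff_left)
qed

lemma mat_fun_add:
  assumes "h holomorphic_on ball 0 R" "k holomorphic_on ball 0 R"
  shows "mat_fun (\<lambda>z. h z + k z) A = mat_fun h A + mat_fun k A"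
proof -
  have "fps_expansion (\<lambda>z. h z + k z) 0 = fps_expansion h 0 + fps_expansion k 0"
    by (intro fps_expansion_eqI has_fps_expansion_add has_taylor_expansion assms)
  then show ?thesis unfolding mat_fun_def
    using suminf_add[OF summable_mat_fun[OF assms(1)] summable_mat_fun[OF assms(2)]]
    by (simp add: scaleR_add_left)
qed

lemma mat_fun_scale:
  assumes "h holomorphic_on ball 0 R"
  shows "mat_fun (\<lambda>z. of_real c * h z) A = c *\<^sub>R mat_fun h A"
proof -
  have "fps_expansion (\<lambda>z. of_real c * h z) 0 = fps_const (of_real c) * fps_expansion h 0"
    by (intro fps_expansion_eqI has_fps_expansion_cmult_left has_taylor_expansion assms)
  then show ?thesis unfolding mat_fun_def
    using suminf_scaleR_right[OF summable_mat_fun[OF assms], of c] by simp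
qed

lemma mat_fun_1: "mat_fun (\<lambda>z. 1) A = mat 1"
proof -
  have "fps_expansion (\<lambda>z. 1) 0 = (1 :: complex fps)" by (intro fps_expansion_eqI has_fps_expansion_1)
  then have "mat_fun (\<lambda>z. 1) A = (\<Sum>j\<in>{0}. Re (fps_nth 1 j) *\<^sub>R mpow A j)"
    unfolding mat_fun_def by (simp only:) (rule suminf_finite, auto)
  then show ?thesis by simp
qed

lemma mat_fun_ident_mult:
  assumes "h holomorphic_on ball 0 R"
  shows "mat_fun (\<lambda>z. z * h z) A = mat_fun h A ** A"
proof -
  have hol: "(\<lambda>z. z * h z) holomorphic_on ball 0 R" by (intro holomorphic_intros assms)
  have F: "fps_expansion (\<lambda>z. z * h z) 0 = fps_X * fps_expansion h 0"
    by (intro fps_expansion_eqI has_fps_expansion_mult has_fps_expansion_fps_X has_taylor_expansion assms)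
  have "mat_fun (\<lambda>z. z * h z) A = (\<Sum>j. Re (taylor (\<lambda>z. z * h z) (Suc j)) *\<^sub>R mpow A (Suc j))"
    unfolding mat_fun_def
    using suminf_split_head[OF summable_mat_fun[OF hol]] by (simp add: F)
  also have "\<dots> = (\<Sum>j. (Re (taylor h j) *\<^sub>R mpow A j) ** A)"
    by (simp add: F matmul.scaleR_left mpow_commute)
  also have "\<dots> = mat_fun h A ** A"
    unfolding mat_fun_def by (rule bounded_linear.suminf[OF matmul.bounded_linear_left summable_mat_fun[OF assms], symmetric])
  finally show ?thesis .
qed

lemma mat_fun_commute:
  assumes "h holomorphic_on ball 0 R"
  shows "mat_fun h A ** A = A ** mat_fun h A"
proof -
  have "mat_fun h A ** A = (\<Sum>j. (Re (taylor h j) *\<^sub>R mpow A j) ** A)"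
    unfolding mat_fun_def by (rule bounded_linear.suminf[OF matmul.bounded_linear_left summable_mat_fun[OF assms]])
  also have "\<dots> = (\<Sum>j. A ** (Re (taylor h j) *\<^sub>R mpow A j))"
    by (simp add: matmul.scaleR_left matmul.scaleR_right mpow_commute)
  also have "\<dots> = A ** mat_fun h A"
    unfolding mat_fun_def by (rule bounded_linear.suminf[OF matmul.bounded_linear_right summable_mat_fun[OF assms], symmetric])
  finally show ?thesis .
qed

lemma mat_fun_power:
  assumes u: "realizes A R u Z"
  shows "mat_fun (\<lambda>z. u z ^ k) A = mpow Z k"
proof (induction k)
  case (Suc k)
  have "mat_fun (\<lambda>z. u z * u z ^ k) A = mat_fun (\<lambda>z. u z ^ k) A ** Z"
    using u unfolding realizes_def by (auto intro!: holomorphic_intros)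
  then show ?case using Suc by (simp add: mpow_commute)
qed (simp add: mat_fun_1)

text \<open>
  The Taylor polynomials of the exponential, composed with \<open>u\<close>, converge uniformly on a circle, so
  their values at \<open>A\<close> converge; these values are the partial sums of the series for \<open>mexp Z\<close>.
\<close>

lemma mat_fun_exp:
  assumes u: "realizes A R u Z"
  shows "mat_fun (\<lambda>z. exp (u z)) A = mexp Z"
proof -
  have hu: "u holomorphic_on ball 0 R" using u unfolding realizes_def by blast
  define P where "P n z = (\<Sum>k\<le>n. u z ^ k / fact k)" for n z
  have hP: "P n holomorphic_on ball 0 R" for n
    unfolding P_def by (intro holomorphic_intros hu) auto
  have PP: "mat_fun (P n) A = (\<Sum>k\<le>n. (1 / fact k) *\<^sub>R mpow Z k)" for n
  proof (induction n)
    case 0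
    then show ?case by (simp add: P_def mat_fun_1)
  next
    case (Suc n)
    have "P (Suc n) = (\<lambda>z. P n z + of_real (1 / fact (Suc n)) * u z ^ Suc n)"
      by (simp add: P_def fun_eq_iff field_simps)
    then have "mat_fun (P (Suc n)) A = mat_fun (\<lambda>z. P n z + of_real (1 / fact (Suc n)) * u z ^ Suc n) A"
      by simp
    also have "\<dots> = mat_fun (P n) A + mat_fun (\<lambda>z. of_real (1 / fact (Suc n)) * u z ^ Suc n) A"
      by (rule mat_fun_add) (intro holomorphic_intros hP hu)+
    also have "mat_fun (\<lambda>z. of_real (1 / fact (Suc n)) * u z ^ Suc n) A
        = (1 / fact (Suc n)) *\<^sub>R mat_fun (\<lambda>z. u z ^ Suc n) A"
      by (rule mat_fun_scale) (intro holomorphic_intros hu)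
    finally have "mat_fun (P (Suc n)) A
        = mat_fun (P n) A + (1 / fact (Suc n)) *\<^sub>R mat_fun (\<lambda>z. u z ^ Suc n) A" .
    then show ?case using Suc mat_fun_power[OF u, of "Suc n"] by simp
  qed
  obtain r where r: "\<rho> < r" "r < R" using dense \<rho>(2) by blast
  obtain U where U: "\<And>z. cmod z = r \<Longrightarrow> cmod (u z) \<le> U"
    using holomorphic_bounded_on_circle[OF hu _ r(2)] r \<rho> by force
  have "cmod (of_real r) = r" using r \<rho> by simp
  from U[OF this] have U0: "U \<ge> 0" using norm_ge_zero order_trans by blast
  obtain K where K: "\<And>h B. h holomorphic_on ball 0 R \<Longrightarrow> (\<And>z. cmod z = r \<Longrightarrow> cmod (h z) \<le> B) \<Longrightarrow>
      norm (mat_fun h A) \<le> K * B"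
    using mat_fun_bound[OF r] by metis
  have "norm (mat_fun (\<lambda>z. exp (u z)) A - mat_fun (P n) A) \<le> K * (exp U * U * (U ^ n / fact n))" for n
  proof -
    have "mat_fun (\<lambda>z. exp (u z)) A - mat_fun (P n) A = mat_fun (\<lambda>z. exp (u z) - P n z) A"
      by (intro mat_fun_diff[symmetric] holomorphic_intros hu hP)
    moreover have "norm (mat_fun (\<lambda>z. exp (u z) - P n z) A) \<le> K * (exp U * U * (U ^ n / fact n))"
    proof (rule K)
      fix z assume z: "cmod z = r"
      have "cmod (exp (u z) - P n z) \<le> exp \<bar>Re (u z)\<bar> * cmod (u z) ^ Suc n / fact n"
        unfolding P_def by (rule Taylor_exp)
      also have "\<dots> \<le> exp U * U ^ Suc n / fact n"
        using U[OF z] abs_Re_le_cmod[of "u z"]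
        by (intro divide_right_mono mult_mono power_mono) auto
      finally show "cmod (exp (u z) - P n z) \<le> exp U * U * (U ^ n / fact n)"
        by (simp add: mult_ac)
    qed (intro holomorphic_intros hu hP)
    ultimately show ?thesis by simp
  qed
  moreover have "(\<lambda>n. K * (exp U * U * (U ^ n / fact n))) \<longlonglongrightarrow> 0"
  proof -
    have "(\<lambda>n. U ^ n / fact n) \<longlonglongrightarrow> 0"
      using summable_LIMSEQ_zero[OF summable_exp[of U]] by (simp only: divide_inverse mult.commute)
    then show ?thesis by (intro tendsto_mult_right_zero)
  qed
  ultimately have "(\<lambda>n. mat_fun (\<lambda>z. exp (u z)) A - mat_fun (P n) A) \<longlonglongrightarrow> 0"
    by (rule Lim_null_comparison[OF always_eventually[OF allI]])
  from tendsto_diff[OF tendsto_const[of "mat_fun (\<lambda>z. exp (u z)) A"] this]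
  have "(\<lambda>n. mat_fun (P n) A) \<longlonglongrightarrow> mat_fun (\<lambda>z. exp (u z)) A" by simp
  then have "(\<lambda>n. \<Sum>k\<le>n. (1 / fact k) *\<^sub>R mpow Z k) \<longlonglongrightarrow> mat_fun (\<lambda>z. exp (u z)) A"
    by (simp only: PP)
  then have "(\<lambda>k. (1 / fact k) *\<^sub>R mpow Z k) sums mat_fun (\<lambda>z. exp (u z)) A"
    unfolding sums_def_le .
  then show ?thesis unfolding mexp_def by (rule sums_unique)
qed

lemma mat_fun_phi:
  assumes u: "realizes A R u Z" and Z: "k = 0 \<or> invertible Z"
  shows "mat_fun (\<lambda>z. phi k (u z)) A = mphi k Z"
  using Z
proof (induction k)
  case 0
  then show ?case using mat_fun_exp[OF u] by simp
next
  case (Suc k)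
  then have inv: "invertible Z" by simp
  have hu: "u holomorphic_on ball 0 R" using u unfolding realizes_def by blast
  have h: "(\<lambda>z. phi j (u z)) holomorphic_on ball 0 R" for j
    using holomorphic_on_compose_gen[OF hu phi_holomorphic] by (simp add: o_def)
  have um: "mat_fun (\<lambda>z. u z * h z) A = mat_fun h A ** Z" if "h holomorphic_on ball 0 R" for h
    using u that unfolding realizes_def by simp
  have "mat_fun (\<lambda>z. phi (Suc k) (u z)) A ** Z = mat_fun (\<lambda>z. u z * phi (Suc k) (u z)) A"
    by (rule um[OF h, symmetric])
  also have "(\<lambda>z. u z * phi (Suc k) (u z)) = (\<lambda>z. phi k (u z) - of_real (1 / fact k) * 1)"
    using phi_Suc_mult by (simp add: mult.commute fun_eq_iff del: phi.simps)
  also have "mat_fun \<dots> A = mat_fun (\<lambda>z. phi k (u z)) A - mat_fun (\<lambda>z. of_real (1 / fact k) * 1) A"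
    by (rule mat_fun_diff) (intro holomorphic_intros h)+
  also have "mat_fun (\<lambda>z. of_real (1 / fact k) * 1) A = (1 / fact k) *\<^sub>R mat_fun (\<lambda>z. 1) A"
    by (rule mat_fun_scale) (intro holomorphic_intros)
  also have "mat_fun (\<lambda>z. phi k (u z)) A - (1 / fact k) *\<^sub>R mat_fun (\<lambda>z. 1) A
      = mphi k Z - (1 / fact k) *\<^sub>R mat 1"
    using Suc inv by (simp add: mat_fun_1)
  finally have "mat_fun (\<lambda>z. phi (Suc k) (u z)) A ** Z ** matrix_inv Z = mphi (Suc k) Z" by simp
  then show ?case using inv by (simp add: matrix_inv_right flip: matrix_mul_assoc)
qed

end

section \<open>The matrix functions of the Krylov method as power series\<close>

lemma inner_transpose_matrix: "x \<bullet> (transpose Q *v y) = (Q *v x) \<bullet> (y :: real^'n)"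
  using dot_lmul_matrix[of y Q x] by (simp add: transpose_matrix_vector inner_commute)

lemma norm_orthonormal_columns:
  fixes Q :: "real^'m^'n"
  assumes "transpose Q ** Q = mat 1"
  shows "norm (Q *v x) = norm x"
  by (metis assms inner_transpose_matrix matrix_vector_mul_assoc matrix_vector_mul_lid norm_eq_sqrt_inner)

lemma num_radius_le_quadratic:
  assumes "num_radius_le T c"
  shows "\<bar>x \<bullet> (T *v x)\<bar> \<le> c * (norm x)\<^sup>2"
proof -
  have "cmod (Complex (x \<bullet> (T *v x)) 0) \<le> c * (norm x)\<^sup>2"
    using assms[unfolded num_radius_le_def, rule_format, of "cvec x 0"] norm_cvec[of x 0]
    by (simp add: cmat_cvec herm_cvec)
  then show ?thesis using abs_Re_le_cmod[of "Complex (x \<bullet> (T *v x)) 0"] by simp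
qed

text \<open>
  An isometry \<open>Q\<close> maps the form of the compression to the form of \<open>A\<close>, so the Hessenberg matrix inherits the disk.
\<close>

lemma num_radius_le_compress:
  fixes Q :: "real^'m^'n"
  assumes "num_radius_le A \<rho>" and Q: "transpose Q ** Q = mat 1"
  shows "num_radius_le (transpose Q ** A ** Q) \<rho>"
  unfolding num_radius_le_def
proof
  fix w :: "complex^'m"
  obtain a b where w: "w = cvec a b" by (rule cvec_surj)
  have norm_Q: "norm (Q *v x) = norm x" for x
    by (rule norm_orthonormal_columns[OF Q])
  have "herm w (cmat (transpose Q ** A ** Q) *v w) = herm (cvec (Q *v a) (Q *v b)) (cmat A *v cvec (Q *v a) (Q *v b))"
    by (simp add: w cmat_cvec herm_cvec inner_transpose_matrix flip: matrix_vector_mul_assoc)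
  moreover have "(norm (cvec (Q *v a) (Q *v b)))\<^sup>2 = (norm w)\<^sup>2" by (simp add: w norm_cvec norm_Q)
  ultimately show "cmod (herm w (cmat (transpose Q ** A ** Q) *v w)) \<le> \<rho> * (norm w)\<^sup>2"
    using assms(1) unfolding num_radius_le_def by metis
qed

lemma power_growth_num_radius:
  assumes "num_radius_le A \<rho>" "\<rho> > 0"
  shows "power_growth (A :: real^'n^'n) \<rho>"
proof -
  have "norm (mpow A j) \<le> (\<Sum>i\<in>(UNIV :: 'n set). \<Sum>k\<in>(UNIV :: 'n set). 2) * \<rho> ^ j" for j
  proof -
    have entry: "\<bar>mpow A j $ i $ k\<bar> \<le> 2 * \<rho> ^ j" for i k
    proof -
      have "\<bar>mpow A j $ i $ k\<bar> = \<bar>(mpow A j *v axis k 1) $ i\<bar>"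
        by (simp add: matrix_vector_mult_basis column_def)
      also have "\<dots> \<le> norm (mpow A j *v axis k 1)" by (rule component_le_norm_cart)
      also have "\<dots> \<le> 2 * \<rho> ^ j" using norm_mpow_le[OF assms, of j "axis k 1"] by simp
      finally show ?thesis .
    qed
    have "norm (mpow A j) \<le> (\<Sum>i\<in>UNIV. norm (mpow A j $ i))"
      unfolding norm_vec_def by (rule L2_set_le_sum) (simp add: L2_set_nonneg)
    also have "\<dots> \<le> (\<Sum>i\<in>(UNIV :: 'n set). \<Sum>k\<in>(UNIV :: 'n set). 2 * \<rho> ^ j)"
      by (rule sum_mono, rule order_trans[OF norm_le_l1_cart], rule sum_mono, rule entry)
    finally show ?thesis by (simp only: sum_distrib_right)
  qed
  then show ?thesis unfolding power_growth_def by (intro exI allI)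
qed

lemma realizes_scale:
  assumes "power_growth A \<rho>" "0 \<le> \<rho>" "\<rho> < R" and u: "realizes A R u Z"
  shows "realizes A R (\<lambda>z. of_real s * u z) (s *\<^sub>R Z)"
  unfolding realizes_def
proof (intro conjI allI impI)
  have hu: "u holomorphic_on ball 0 R"
    and um: "\<And>h. h holomorphic_on ball 0 R \<Longrightarrow> mat_fun (\<lambda>z. u z * h z) A = mat_fun h A ** Z"
    using u unfolding realizes_def by auto
  show "(\<lambda>z. of_real s * u z) holomorphic_on ball 0 R" by (intro holomorphic_intros hu)
  fix h assume h: "h holomorphic_on ball 0 R"
  have "mat_fun (\<lambda>z. of_real s * (u z * h z)) A = s *\<^sub>R mat_fun (\<lambda>z. u z * h z) A"
    by (rule mat_fun_scale[OF assms(1-3)]) (intro holomorphic_intros hu h)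
  then show "mat_fun (\<lambda>z. of_real s * u z * h z) A = mat_fun h A ** (s *\<^sub>R Z)"
    by (simp add: um[OF h] mult.assoc matmul.scaleR_right)
qed

lemma mat_fun_shift_mult:
  assumes g: "power_growth A \<rho>" "0 \<le> \<rho>" "\<rho> < R" and h: "h holomorphic_on ball 0 R"
  shows "mat_fun (\<lambda>z. (of_real c + z) * h z) A = mat_fun h A ** (A + c *\<^sub>R mat 1)"
proof -
  have "mat_fun (\<lambda>z. of_real c * h z + z * h z) A = mat_fun (\<lambda>z. of_real c * h z) A + mat_fun (\<lambda>z. z * h z) A"
    by (rule mat_fun_add[OF g]) (intro holomorphic_intros h)+
  then show ?thesis
    by (simp add: mat_fun_scale[OF g h] mat_fun_ident_mult[OF g h] ring_distribs matmul.add_right matmul.scaleR_right)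
qed

lemma shift_nonzero:
  assumes "R \<le> c" "z \<in> ball 0 R"
  shows "of_real c + z \<noteq> (0::complex)"
proof
  assume "of_real c + z = 0"
  then have "z = - of_real c" by (simp add: eq_neg_iff_add_eq_0 add.commute)
  then show False using assms by simp
qed

lemma g1_inv_holomorphic:
  assumes "R \<le> c"
  shows "(\<lambda>z. g1_inv \<gamma> (of_real c + z)) holomorphic_on ball 0 R"
proof (cases "\<gamma> = 0")
  case False
  then show ?thesis unfolding g1_inv_def
    by (intro holomorphic_intros) (use shift_nonzero[OF assms] in auto)
qed (simp add: g1_inv_def)

text \<open>
  On the disk, \<open>z g\<^sub>1(z)\<^sup>-\<^sup>1 = (1 - z) / \<gamma>\<close>. Evaluated in \<open>A\<close>, this identity determines
  the product with \<open>g\<^sub>1\<^sup>-\<^sup>1\<close> up to a factor \<open>M\<close>, which can be cancelled.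
\<close>

lemma realizes_g1_inv:
  assumes g: "power_growth A \<rho>" "0 \<le> \<rho>" "\<rho> < R" and c: "R \<le> c" and "\<gamma> \<noteq> 0"
    and inv: "invertible (A + c *\<^sub>R mat 1)"
  shows "realizes A R (\<lambda>z. g1_inv \<gamma> (of_real c + z)) (g1_inv_mat \<gamma> (A + c *\<^sub>R mat 1))"
  unfolding realizes_def
proof (intro conjI allI impI)
  show hol: "(\<lambda>z. g1_inv \<gamma> (of_real c + z)) holomorphic_on ball 0 R" by (rule g1_inv_holomorphic[OF c])
  fix h assume h: "h holomorphic_on ball 0 R"
  define M where "M = A + c *\<^sub>R mat 1"
  define P where "P = mat_fun (\<lambda>z. g1_inv \<gamma> (of_real c + z) * h z) A"
  have h2: "(\<lambda>z. (of_real c + z) * h z) holomorphic_on ball 0 R"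
    by (intro holomorphic_intros h)
  have "P ** M = mat_fun (\<lambda>z. (of_real c + z) * (g1_inv \<gamma> (of_real c + z) * h z)) A"
    unfolding P_def M_def by (rule mat_fun_shift_mult[OF g, symmetric]) (intro holomorphic_intros hol h)
  also have "\<dots> = mat_fun (\<lambda>z. of_real (1 / \<gamma>) * (h z - (of_real c + z) * h z)) A"
  proof (rule mat_fun_cong[OF g])
    fix z :: complex assume "cmod z < R"
    then have "of_real c + z \<noteq> 0" using shift_nonzero[OF c] by simp
    then show "(of_real c + z) * (g1_inv \<gamma> (of_real c + z) * h z)
        = of_real (1 / \<gamma>) * (h z - (of_real c + z) * h z)"
      using \<open>\<gamma> \<noteq> 0\<close> by (simp add: g1_inv_def divide_simps) (simp add: algebra_simps)
  qed
  also have "\<dots> = (1 / \<gamma>) *\<^sub>R mat_fun (\<lambda>z. h z - (of_real c + z) * h z) A"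
    by (rule mat_fun_scale[OF g]) (intro holomorphic_intros h)
  also have "mat_fun (\<lambda>z. h z - (of_real c + z) * h z) A = mat_fun h A - mat_fun h A ** M"
    by (simp add: mat_fun_diff[OF g h h2] mat_fun_shift_mult[OF g h] M_def)
  finally have "P ** M ** matrix_inv M = ((1 / \<gamma>) *\<^sub>R (mat_fun h A - mat_fun h A ** M)) ** matrix_inv M"
    by simp
  moreover have "M ** matrix_inv M = mat 1" using inv unfolding M_def by (rule matrix_inv_right)
  ultimately have "P = mat_fun h A ** g1_inv_mat \<gamma> M"
    by (simp add: g1_inv_mat_def matmul.diff_left matmul.diff_right matmul.scaleR_left matmul.scaleR_right flip: matrix_mul_assoc)
  then show "mat_fun (\<lambda>z. g1_inv \<gamma> (of_real c + z) * h z) A = mat_fun h A ** g1_inv_mat \<gamma> (A + c *\<^sub>R mat 1)"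
    by (simp add: P_def M_def)
qed

lemma phi_compose_holomorphic:
  assumes "u holomorphic_on X" shows "(\<lambda>z. phi k (u z)) holomorphic_on X"
proof -
  have "(phi k \<circ> u) holomorphic_on X"
    by (rule holomorphic_on_compose_gen[OF assms phi_holomorphic]) simp
  then show ?thesis by (simp only: o_def)
qed

lemma phi_g1_inv_holomorphic:
  assumes "R \<le> c"
  shows "(\<lambda>z. phi k (- of_real t * g1_inv \<gamma> (of_real c + z))) holomorphic_on ball 0 R"
  by (rule phi_compose_holomorphic[OF holomorphic_on_mult[OF holomorphic_on_const g1_inv_holomorphic[OF assms]]])

lemma f0_holomorphic:
  assumes "R \<le> c" shows "(\<lambda>z. f0 \<gamma> t (of_real c + z)) holomorphic_on ball 0 R"
  unfolding f0_def by (rule phi_g1_inv_holomorphic[OF assms])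

lemma fk_holomorphic:
  assumes "R \<le> c" shows "(\<lambda>z. fk k \<gamma> t (of_real c + z)) holomorphic_on ball 0 R"
  unfolding fk_def
  by (rule holomorphic_on_mult[OF g1_inv_holomorphic[OF assms] phi_g1_inv_holomorphic[OF assms]])

lemma matrix_inv_commute:
  assumes "invertible (M :: real^'n^'n)" "X ** M = M ** X"
  shows "X ** matrix_inv M = matrix_inv M ** X"
proof -
  have "matrix_inv M ** (X ** M) ** matrix_inv M = matrix_inv M ** (M ** X) ** matrix_inv M"
    using assms(2) by simp
  then show ?thesis
    by (metis assms(1) matrix_inv_left matrix_inv_right matrix_mul_assoc matrix_mul_lid matrix_mul_rid)
qed

context
  fixes M :: "real^'n^'n" and \<rho> c \<gamma> :: real
  assumes nr: "num_radius_le (M - c *\<^sub>R mat 1) \<rho>" and \<rho>: "0 < \<rho>" "\<rho> < c" "c + \<rho> < 1" and \<gamma>: "\<gamma> \<noteq> 0"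
begin

text \<open>
  Since the disk around \<open>c\<close> contains neither \<open>0\<close> nor \<open>1\<close>, this makes both \<open>M\<close> and \<open>M - I\<close>
  invertible. Invertibility of \<open>M - I\<close> is what the phi-functions of \<open>g\<^sub>1(M)\<^sup>-\<^sup>1\<close> require, because they are
  defined by division.
\<close>

lemma eigenvalue_in_disk:
  assumes "M *v x = s *\<^sub>R x" "x \<noteq> 0"
  shows "\<bar>s - c\<bar> \<le> \<rho>"
proof -
  have "(M - c *\<^sub>R mat 1) *v x = (s - c) *\<^sub>R x"
    by (simp add: matrix_vector_mult_diff_rdistrib assms scaleR_diff_left flip: scaleR_matrix_vector_assoc)
  then have "\<bar>s - c\<bar> * (norm x)\<^sup>2 \<le> \<rho> * (norm x)\<^sup>2"
    using num_radius_le_quadratic[OF nr, of x] by (simp add: power2_norm_eq_inner abs_mult)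
  then show ?thesis using assms(2) by simp
qed

lemma invertible_disk: "invertible M"
proof (rule invertible_if_ker)
  fix x assume "M *v x = 0"
  then show "x = 0" using eigenvalue_in_disk[of x 0] \<rho> by (cases "x = 0") simp_all
qed

lemma invertible_g1_inv_mat: "invertible (g1_inv_mat \<gamma> M)"
proof (rule invertible_if_ker)
  fix x assume "g1_inv_mat \<gamma> M *v x = 0"
  then have "matrix_inv M *v x = x"
    using \<gamma> by (simp add: g1_inv_mat_def matrix_vector_mult_diff_rdistrib flip: scaleR_matrix_vector_assoc)
  then have "M *v x = x"
    by (metis invertible_disk matrix_inv_right matrix_vector_mul_assoc matrix_vector_mul_lid)
  then show "x = 0" using eigenvalue_in_disk[of x 1] \<rho> by (cases "x = 0") simp_all
qed

lemma realizes_disk: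
  "realizes (M - c *\<^sub>R mat 1) c (\<lambda>z. - of_real t * g1_inv \<gamma> (of_real c + z)) (- t *\<^sub>R g1_inv_mat \<gamma> M)"
  "realizes (M - c *\<^sub>R mat 1) c (\<lambda>z. g1_inv \<gamma> (of_real c + z)) (g1_inv_mat \<gamma> M)"
proof -
  note g = power_growth_num_radius[OF nr \<rho>(1)] less_imp_le[OF \<rho>(1)] \<rho>(2)
  show *: "realizes (M - c *\<^sub>R mat 1) c (\<lambda>z. g1_inv \<gamma> (of_real c + z)) (g1_inv_mat \<gamma> M)"
    using realizes_g1_inv[OF g order_refl \<gamma>] invertible_disk by simp
  show "realizes (M - c *\<^sub>R mat 1) c (\<lambda>z. - of_real t * g1_inv \<gamma> (of_real c + z)) (- t *\<^sub>R g1_inv_mat \<gamma> M)"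
    using realizes_scale[OF g *, of "-t"] by simp
qed

lemma f0_mat_eq: "f0_mat \<gamma> t M = mat_fun (\<lambda>z. f0 \<gamma> t (of_real c + z)) (M - c *\<^sub>R mat 1)"
  unfolding f0_mat_def f0_def
  by (rule mat_fun_phi[OF power_growth_num_radius[OF nr \<rho>(1)] less_imp_le[OF \<rho>(1)] \<rho>(2)
        realizes_disk(1), symmetric]) simp

text \<open>
  The case \<open>t = 0\<close> has to be excluded, because the argument of the phi-function is then the zero
  matrix, by which \<open>mphi k\<close> would divide for \<open>k \<ge> 1\<close>.
\<close>

lemma fk_mat_eq:
  assumes "t \<noteq> 0"
  shows "fk_mat k \<gamma> t M = mat_fun (\<lambda>z. fk k \<gamma> t (of_real c + z)) (M - c *\<^sub>R mat 1)"
proof -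
  define A where "A = M - c *\<^sub>R mat 1"
  define p where "p z = phi k (- of_real t * g1_inv \<gamma> (of_real c + z))" for z
  note g = power_growth_num_radius[OF nr \<rho>(1)] less_imp_le[OF \<rho>(1)] \<rho>(2)
  have hp: "p holomorphic_on ball 0 c"
    unfolding p_def by (rule phi_g1_inv_holomorphic) simp
  have "invertible (- t *\<^sub>R g1_inv_mat \<gamma> M)"
    using assms matrix_inv_right[OF invertible_g1_inv_mat]
    by (intro invertibleI(1)[of _ "(- 1 / t) *\<^sub>R matrix_inv (g1_inv_mat \<gamma> M)"])
      (simp add: matmul.scaleR_left matmul.scaleR_right matmul.minus_left matmul.minus_right)
  then have p: "mat_fun p A = mphi k (- t *\<^sub>R g1_inv_mat \<gamma> M)"
    unfolding p_def A_def by (intro mat_fun_phi[OF g realizes_disk(1)]) simp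
  have "mat_fun p A ** M = M ** mat_fun p A"
    using mat_fun_commute[OF g hp] unfolding A_def
    by (simp add: matmul.diff_left matmul.diff_right matmul.scaleR_left matmul.scaleR_right)
  then have "mat_fun p A ** g1_inv_mat \<gamma> M = g1_inv_mat \<gamma> M ** mat_fun p A"
    using matrix_inv_commute[OF invertible_disk]
    by (simp add: g1_inv_mat_def matmul.diff_left matmul.diff_right matmul.scaleR_left matmul.scaleR_right)
  moreover have "mat_fun (\<lambda>z. fk k \<gamma> t (of_real c + z)) A = mat_fun p A ** g1_inv_mat \<gamma> M"
    using realizes_disk(2) hp unfolding realizes_def A_def fk_def p_def by simp
  ultimately show ?thesis unfolding fk_mat_def p[symmetric] A_def[symmetric] by simp
qed

end

section \<open>Exactness and error of Krylov projections\<close>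

lemma span_columns_projection:
  fixes Q :: "real^'m^'n"
  assumes Q: "transpose Q ** Q = mat 1" and y: "y \<in> span (columns Q)"
  shows "Q *v (transpose Q *v y) = y"
proof -
  have "columns Q \<subseteq> {y. Q *v (transpose Q *v y) = y}"
  proof
    fix y assume "y \<in> columns Q"
    then obtain i where "y = Q *v axis i 1" unfolding columns_def by (auto simp: matrix_vector_mult_basis)
    then show "y \<in> {y. Q *v (transpose Q *v y) = y}"
      by (simp add: matrix_vector_mul_assoc Q flip: matrix_mul_assoc)
  qed
  moreover have "subspace {y. Q *v (transpose Q *v y) = y}"
    by (auto simp: subspace_def matrix_vector_right_distrib matrix_vector_mult_scaleR)
  ultimately show ?thesis using y span_minimal by blast
qed

text \<open>
  The Krylov spaces do not change when the matrix is shifted by a multiple of the identity.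
\<close>

lemma mpow_shift_in_krylov:
  fixes E :: "real^'n^'n"
  shows "mpow (E - c *\<^sub>R mat 1) j *v w \<in> span {mpow E i *v w |i. i \<le> j}"
proof (induction j)
  case 0
  show ?case by (intro span_base) auto
next
  case (Suc j)
  define y where "y = mpow (E - c *\<^sub>R mat 1) j *v w"
  have "E *v y \<in> (*v) E ` span {mpow E i *v w |i. i \<le> j}" using Suc y_def by blast
  also have "\<dots> = span ((*v) E ` {mpow E i *v w |i. i \<le> j})"
    by (rule linear_span_image[symmetric]) simp
  also have "\<dots> \<subseteq> span {mpow E i *v w |i. i \<le> Suc j}"
  proof (rule span_mono, safe)
    fix i assume "i \<le> j"
    then show "\<exists>i'. E *v (mpow E i *v w) = mpow E i' *v w \<and> i' \<le> Suc j"
      by (intro exI[of _ "Suc i"]) (simp add: matrix_vector_mul_assoc)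
  qed
  finally have "E *v y \<in> span {mpow E i *v w |i. i \<le> Suc j}" .
  moreover have "y \<in> span {mpow E i *v w |i. i \<le> Suc j}"
    using Suc unfolding y_def by (rule subsetD[OF span_mono, rotated]) auto
  ultimately have "E *v y - c *\<^sub>R y \<in> span {mpow E i *v w |i. i \<le> Suc j}"
    by (intro span_diff span_scale)
  also have "E *v y - c *\<^sub>R y = mpow (E - c *\<^sub>R mat 1) (Suc j) *v w"
    by (simp add: y_def matrix_vector_mult_diff_rdistrib flip: scaleR_matrix_vector_assoc matrix_vector_mul_assoc)
  finally show ?case .
qed

text \<open>
  \<open>Q Q\<^sup>T\<close> is the projection onto the Krylov space, and \<open>w, A w, \<dots>, A\<^sup>j w\<close> all lie in this space as long
  as \<open>j < m\<close>. So the projections between the factors of \<open>(Q Q\<^sup>T A Q Q\<^sup>T)\<^sup>j w\<close> have no effect.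
\<close>

lemma krylov_exact:
  fixes Q :: "real^'m^'n" and E :: "real^'n^'n"
  assumes Q: "transpose Q ** Q = mat 1"
    and sp: "span (columns Q) = span {mpow E j *v w |j. j < CARD('m)}"
    and j: "j < CARD('m)"
  shows "Q *v (mpow (transpose Q ** (E - c *\<^sub>R mat 1) ** Q) j *v (transpose Q *v w))
    = mpow (E - c *\<^sub>R mat 1) j *v w"
proof -
  define A where "A = E - c *\<^sub>R mat 1"
  have proj: "Q *v (transpose Q *v (mpow A i *v w)) = mpow A i *v w" if "i < CARD('m)" for i
  proof (rule span_columns_projection[OF Q])
    have "{mpow E k *v w |k. k \<le> i} \<subseteq> {mpow E k *v w |k. k < CARD('m)}" using that by auto
    then show "mpow A i *v w \<in> span (columns Q)"
      using mpow_shift_in_krylov[of E c i w] span_mono unfolding sp A_def by blast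
  qed
  show ?thesis using j unfolding A_def[symmetric]
  proof (induction j)
    case 0
    then show ?case using proj[of 0] by simp
  next
    case (Suc j)
    then have IH: "Q *v (mpow (transpose Q ** A ** Q) j *v (transpose Q *v w)) = mpow A j *v w" by simp
    have "Q *v (mpow (transpose Q ** A ** Q) (Suc j) *v (transpose Q *v w))
      = Q *v (transpose Q *v (A *v (Q *v (mpow (transpose Q ** A ** Q) j *v (transpose Q *v w)))))"
      by (simp flip: matrix_vector_mul_assoc)
    also have "\<dots> = mpow A (Suc j) *v w"
      using proj[of "Suc j"] Suc.prems by (simp add: IH flip: matrix_vector_mul_assoc)
    finally show ?case .
  qed
qed

text \<open>
  The first \<open>m\<close> terms of the two power series cancel by exactness. In each remaining
  term the \<open>j\<close>-th power of the shifted matrix has norm at most \<open>2 \<rho>\<^sup>j\<close>, both for \<open>E\<close> and for \<open>H\<close>.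
\<close>

lemma krylov_term_bound:
  fixes Q :: "real^'m^'n" and E :: "real^'n^'n"
  assumes nr: "num_radius_le (E - c *\<^sub>R mat 1) \<rho>" and \<rho>: "0 < \<rho>" "\<rho> < R"
    and Q: "transpose Q ** Q = mat 1"
    and sp: "span (columns Q) = span {mpow E j *v w |j. j < CARD('m)}"
    and H: "H = transpose Q ** E ** Q"
    and h: "h holomorphic_on ball 0 R"
    and smb: "summable (\<lambda>j. cmod (taylor h j) * \<rho> ^ j)"
  shows "norm (mat_fun h (E - c *\<^sub>R mat 1) *v w - Q *v (mat_fun h (H - c *\<^sub>R mat 1) *v (transpose Q *v w)))
    \<le> 4 * norm w * (\<Sum>j. cmod (taylor h (j + CARD('m))) * \<rho> ^ (j + CARD('m)))"
proof -
  define A where "A = E - c *\<^sub>R mat 1"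
  define K where "K = H - c *\<^sub>R mat 1"
  define m where "m = CARD('m)"
  have K: "K = transpose Q ** A ** Q"
    by (simp add: K_def A_def H matmul.diff_left matmul.diff_right matmul.scaleR_left matmul.scaleR_right Q)
  have nrK: "num_radius_le K \<rho>" unfolding K A_def by (rule num_radius_le_compress[OF nr Q])
  note gA = power_growth_num_radius[OF nr \<rho>(1), folded A_def] less_imp_le[OF \<rho>(1)] \<rho>(2)
  note gK = power_growth_num_radius[OF nrK \<rho>(1)] less_imp_le[OF \<rho>(1)] \<rho>(2)
  have norm_Q: "norm (Q *v x) = norm x" for x
    by (rule norm_orthonormal_columns[OF Q])
  have norm_QT: "norm (transpose Q *v x) \<le> norm x" for x
  proof -
    have "(norm (transpose Q *v x))\<^sup>2 = (Q *v (transpose Q *v x)) \<bullet> x"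
      by (metis inner_transpose_matrix power2_norm_eq_inner)
    also have "\<dots> \<le> norm (transpose Q *v x) * norm x"
      using norm_cauchy_schwarz[of "Q *v (transpose Q *v x)" x] by (simp add: norm_Q)
    finally show ?thesis by (cases "transpose Q *v x = 0") (simp_all add: power2_eq_square)
  qed
  define D where "D j = mpow A j *v w - Q *v (mpow K j *v (transpose Q *v w))" for j
  have D0: "D j = 0" if "j < m" for j
    using krylov_exact[OF Q sp, of j c] that by (simp add: D_def K A_def m_def)
  have Dn: "norm (D j) \<le> 4 * norm w * \<rho> ^ j" for j
  proof -
    have "norm (D j) \<le> norm (mpow A j *v w) + norm (mpow K j *v (transpose Q *v w))"
      unfolding D_def using norm_triangle_ineq4 norm_Q by metis
    also have "\<dots> \<le> 2 * \<rho> ^ j * norm w + 2 * \<rho> ^ j * norm (transpose Q *v w)"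
      using norm_mpow_le[OF nr \<rho>(1), folded A_def] norm_mpow_le[OF nrK \<rho>(1)] by (intro add_mono)
    also have "\<dots> \<le> 2 * \<rho> ^ j * norm w + 2 * \<rho> ^ j * norm w"
      using norm_QT \<rho> by (intro add_mono mult_left_mono) auto
    finally show ?thesis by (simp add: algebra_simps)
  qed
  have blin: "bounded_linear (\<lambda>X :: real^'k^'k. X *v x)" for x :: "real^'k"
    unfolding linear_conv_bounded_linear[symmetric]
    by (auto intro!: linearI simp: matrix_vector_mult_add_rdistrib scaleR_matrix_vector_assoc)
  have blinQ: "bounded_linear ((*v) Q)" by (simp add: linear_conv_bounded_linear[symmetric])
  have "(\<lambda>j. Re (taylor h j) *\<^sub>R (mpow A j *v w)) sums (mat_fun h A *v w)"
    using bounded_linear.sums[OF blin summable_sums[OF summable_mat_fun[OF gA h]], of w]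
    by (simp add: mat_fun_def flip: scaleR_matrix_vector_assoc)
  moreover have "(\<lambda>j. Re (taylor h j) *\<^sub>R (Q *v (mpow K j *v (transpose Q *v w)))) sums
      (Q *v (mat_fun h K *v (transpose Q *v w)))"
    using bounded_linear.sums[OF blinQ bounded_linear.sums[OF blin summable_sums[OF summable_mat_fun[OF gK h]],
          of "transpose Q *v w"]]
    by (simp add: mat_fun_def matrix_vector_mult_scaleR flip: scaleR_matrix_vector_assoc)
  ultimately have sums: "(\<lambda>j. Re (taylor h j) *\<^sub>R D j) sums
      (mat_fun h A *v w - Q *v (mat_fun h K *v (transpose Q *v w)))" (is "_ sums ?e")
    unfolding D_def using sums_diff by (fastforce simp: scaleR_diff_right)
  have "(\<lambda>j. Re (taylor h (j + m)) *\<^sub>R D (j + m)) sums ?e"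
    using sums_iff_shift[of "\<lambda>j. Re (taylor h j) *\<^sub>R D j" m ?e] sums D0 by simp
  from sums_unique[OF this] have "norm ?e = norm (\<Sum>j. Re (taylor h (j + m)) *\<^sub>R D (j + m))"
    by (rule arg_cong)
  also have "\<dots> \<le> (\<Sum>j. 4 * norm w * (cmod (taylor h (j + m)) * \<rho> ^ (j + m)))"
  proof (rule norm_suminf_le)
    fix j
    have "norm (Re (taylor h (j + m)) *\<^sub>R D (j + m)) \<le> cmod (taylor h (j + m)) * (4 * norm w * \<rho> ^ (j + m))"
      unfolding norm_scaleR using \<rho> by (intro mult_mono abs_Re_le_cmod Dn) auto
    then show "norm (Re (taylor h (j + m)) *\<^sub>R D (j + m)) \<le> 4 * norm w * (cmod (taylor h (j + m)) * \<rho> ^ (j + m))"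
      by (simp add: mult_ac)
  next
    show "summable (\<lambda>j. 4 * norm w * (cmod (taylor h (j + m)) * \<rho> ^ (j + m)))"
      using summable_ignore_initial_segment[OF smb, of m] by (rule summable_mult)
  qed
  also have "\<dots> = 4 * norm w * (\<Sum>j. cmod (taylor h (j + m)) * \<rho> ^ (j + m))"
    using summable_ignore_initial_segment[OF smb, of m] by (rule suminf_mult)
  finally show ?thesis by (simp add: A_def K_def m_def)
qed

text \<open>
  Estimating the functions one at a time would give the sum of their maxima on the circle. To obtain
  the maximum of the weighted sum, the phases of the \<open>j\<close>-th coefficients are absorbed into the
  weights, and Cauchy's estimate is applied to the resulting linear combination.
\<close>

lemma cauchy_estimate_sum:
  assumes h: "\<And>i. i \<in> I \<Longrightarrow> h i holomorphic_on ball 0 R" and r: "0 < r" "r < R"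
    and B: "\<And>z. cmod z = r \<Longrightarrow> (\<Sum>i\<in>I. s i * cmod (h i z)) \<le> B"
    and s: "\<And>i. i \<in> I \<Longrightarrow> s i \<ge> 0"
  shows "(\<Sum>i\<in>I. s i * cmod (taylor (h i) j)) \<le> B / r ^ j"
proof -
  have "\<exists>u. cmod u = 1 \<and> u * a = of_real (cmod a)" for a
  proof (cases "a = 0")
    case False
    then show ?thesis by (intro exI[of _ "of_real (cmod a) / a"]) (simp add: norm_divide)
  qed (auto intro: exI[of _ 1])
  then obtain u where u: "\<And>a. cmod (u a) = 1" "\<And>a. u a * a = of_real (cmod a)" by metis
  define v where "v i = of_real (s i) * u (taylor (h i) j)" for i
  define F where "F z = (\<Sum>i\<in>I. v i * h i z)" for z
  have hF: "F holomorphic_on ball 0 R" unfolding F_def by (intro holomorphic_intros h)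
  have "R > 0" using r by simp
  then have "fps_expansion F 0 = (\<Sum>i\<in>I. fps_const (v i) * fps_expansion (h i) 0)"
    unfolding F_def
    by (intro fps_expansion_eqI has_fps_expansion_sum has_fps_expansion_cmult_left
        has_fps_expansion_fps_expansion[of "ball 0 R"] h) auto
  then have "taylor F j = (\<Sum>i\<in>I. v i * taylor (h i) j)" by (simp add: fps_sum_nth)
  also have "\<dots> = of_real (\<Sum>i\<in>I. s i * cmod (taylor (h i) j))"
    by (simp add: v_def mult.assoc u)
  finally have "cmod (taylor F j) = (\<Sum>i\<in>I. s i * cmod (taylor (h i) j))"
    using s by (simp only: norm_of_real) (simp add: sum_nonneg)
  moreover have "cmod (taylor F j) \<le> B / r ^ j"
  proof (rule cauchy_estimate[OF hF r])
    fix z assume "cmod z = r"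
    have "cmod (F z) \<le> (\<Sum>i\<in>I. cmod (v i * h i z))" unfolding F_def by (rule norm_sum)
    also have "\<dots> = (\<Sum>i\<in>I. s i * cmod (h i z))"
      by (rule sum.cong) (auto simp: v_def norm_mult u s)
    also have "\<dots> \<le> B" using B \<open>cmod z = r\<close> .
    finally show "cmod (F z) \<le> B" .
  qed
  ultimately show ?thesis by simp
qed

lemma taylor_summable:
  assumes h: "h holomorphic_on ball 0 R" and \<rho>: "0 < \<rho>" "\<rho> < R"
  shows "summable (\<lambda>j. cmod (taylor h j) * \<rho> ^ j)"
proof -
  obtain r where r: "\<rho> < r" "r < R" using dense \<rho>(2) by blast
  obtain B where B: "\<And>z. cmod z = r \<Longrightarrow> cmod (h z) \<le> B"
    using holomorphic_bounded_on_circle[OF h _ r(2)] r \<rho> by force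
  have "summable (\<lambda>j. B * (\<rho> / r) ^ j)" using r \<rho> by (intro summable_mult summable_geometric) auto
  then show ?thesis
  proof (rule summable_comparison_test'[of _ 0])
    fix j
    have "cmod (taylor h j) * \<rho> ^ j \<le> B / r ^ j * \<rho> ^ j"
      using cauchy_estimate[OF h _ r(2) B, of j] r \<rho> by (intro mult_right_mono) auto
    then show "norm (cmod (taylor h j) * \<rho> ^ j) \<le> B * (\<rho> / r) ^ j"
      using \<rho> by (simp add: power_divide)
  qed
qed

lemma taylor_tail_sum_bound:
  assumes I: "finite I" and h: "\<And>i. i \<in> I \<Longrightarrow> h i holomorphic_on ball 0 R"
    and r: "0 < \<rho>" "\<rho> < r" "r < R"
    and B: "\<And>z. cmod z = r \<Longrightarrow> (\<Sum>i\<in>I. s i * cmod (h i z)) \<le> B"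
    and s: "\<And>i. i \<in> I \<Longrightarrow> s i \<ge> 0"
  shows "(\<Sum>i\<in>I. s i * (\<Sum>j. cmod (taylor (h i) (j + m)) * \<rho> ^ (j + m))) \<le> B * r / (r - \<rho>) * (\<rho> / r) ^ m"
proof -
  have q: "norm (\<rho> / r) < 1" using r by auto
  have smb: "summable (\<lambda>j. cmod (taylor (h i) (j + m)) * \<rho> ^ (j + m))" if "i \<in> I" for i
    using taylor_summable[OF h[OF that], of \<rho>] r by (intro summable_ignore_initial_segment) auto
  have smb2: "summable (\<lambda>j. s i * (cmod (taylor (h i) (j + m)) * \<rho> ^ (j + m)))" if "i \<in> I" for i
    by (rule summable_mult[OF smb[OF that]])
  have "(\<Sum>i\<in>I. s i * (\<Sum>j. cmod (taylor (h i) (j + m)) * \<rho> ^ (j + m)))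
      = (\<Sum>i\<in>I. \<Sum>j. s i * (cmod (taylor (h i) (j + m)) * \<rho> ^ (j + m)))"
    by (rule sum.cong[OF refl]) (rule suminf_mult[symmetric, OF smb])
  also have "\<dots> = (\<Sum>j. \<Sum>i\<in>I. s i * (cmod (taylor (h i) (j + m)) * \<rho> ^ (j + m)))"
    by (rule suminf_sum[symmetric, OF smb2])
  also have "\<dots> \<le> (\<Sum>j. B * (\<rho> / r) ^ m * (\<rho> / r) ^ j)"
  proof (rule suminf_le)
    fix j
    have "(\<Sum>i\<in>I. s i * cmod (taylor (h i) (j + m))) \<le> B / r ^ (j + m)"
      by (rule cauchy_estimate_sum[OF h _ r(3) B s]) (use r in auto)
    then have "(\<Sum>i\<in>I. s i * cmod (taylor (h i) (j + m))) * \<rho> ^ (j + m) \<le> B / r ^ (j + m) * \<rho> ^ (j + m)"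
      using r by (intro mult_right_mono) auto
    moreover have "(\<Sum>i\<in>I. s i * (cmod (taylor (h i) (j + m)) * \<rho> ^ (j + m)))
        = (\<Sum>i\<in>I. s i * cmod (taylor (h i) (j + m))) * \<rho> ^ (j + m)"
      by (simp only: sum_distrib_right mult.assoc)
    ultimately show "(\<Sum>i\<in>I. s i * (cmod (taylor (h i) (j + m)) * \<rho> ^ (j + m)))
        \<le> B * (\<rho> / r) ^ m * (\<rho> / r) ^ j"
      by (simp add: power_divide power_add mult_ac)
  next
    show "summable (\<lambda>j. \<Sum>i\<in>I. s i * (cmod (taylor (h i) (j + m)) * \<rho> ^ (j + m)))"
      by (rule summable_sum) (rule smb2)
    show "summable (\<lambda>j. B * (\<rho> / r) ^ m * (\<rho> / r) ^ j)"
      by (rule summable_mult[OF summable_geometric[OF q]])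
  qed
  also have "\<dots> = B * (\<rho> / r) ^ m * (1 / (1 - \<rho> / r))"
    using suminf_mult[OF summable_geometric[OF q], of "B * (\<rho> / r) ^ m"] suminf_geometric[OF q] by simp
  also have "\<dots> = B * r / (r - \<rho>) * (\<rho> / r) ^ m"
    using r by (simp add: field_simps)
  finally show ?thesis .
qed

section \<open>Positive definite matrices\<close>

lemma pos_def_invertible: "pos_def A \<Longrightarrow> invertible A"
  by (rule invertible_if_ker) (metis inner_zero_right less_irrefl pos_def_def)

lemma pos_def_matrix_inv:
  assumes "pos_def A" shows "pos_def (matrix_inv A)"
  unfolding pos_def_def
proof (intro allI impI)
  fix v :: "real^'a" assume "v \<noteq> 0"
  define y where "y = matrix_inv A *v v"
  have v: "v = A *v y"
    by (simp add: y_def matrix_vector_mul_assoc matrix_inv_right[OF pos_def_invertible[OF assms]])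
  with \<open>v \<noteq> 0\<close> have "y \<noteq> 0" by auto
  then have "0 < y \<bullet> (A *v y)" using assms unfolding pos_def_def by blast
  then show "0 < v \<bullet> (matrix_inv A *v v)" by (simp add: y_def[symmetric] v[symmetric] inner_commute)
qed

lemma pos_def_compress:
  assumes "pos_def A" and inj: "\<And>x. U *v x = 0 \<Longrightarrow> x = 0"
  shows "pos_def (transpose U ** A ** U)"
  unfolding pos_def_def
proof (intro allI impI)
  fix v :: "real^'b" assume "v \<noteq> 0"
  then have "U *v v \<noteq> 0" using inj by blast
  then have "0 < (U *v v) \<bullet> (A *v (U *v v))" using assms(1) unfolding pos_def_def by blast
  then show "0 < v \<bullet> ((transpose U ** A ** U) *v v)"
    by (simp add: inner_transpose_matrix flip: matrix_vector_mul_assoc)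
qed

lemma pos_def_add_scaled:
  assumes "\<And>v. 0 \<le> v \<bullet> (A *v v)" "pos_def B" "\<gamma> > 0"
  shows "pos_def (A + \<gamma> *\<^sub>R B)"
  unfolding pos_def_def
proof (intro allI impI)
  fix v :: "real^'a" assume "v \<noteq> 0"
  then have "0 < \<gamma> * (v \<bullet> (B *v v))" using assms unfolding pos_def_def by simp
  then show "0 < v \<bullet> ((A + \<gamma> *\<^sub>R B) *v v)"
    using assms(1)[of v]
    by (simp add: matrix_vector_mult_add_rdistrib inner_add_right flip: scaleR_matrix_vector_assoc)
qed

text \<open>
  If \<open>x \<bullet> D x \<ge> \<delta> |x|\<^sup>2\<close> and \<open>|D x| \<le> L |x|\<close>, then
  \<open>|D x - c x|\<^sup>2 \<le> (L\<^sup>2 - 2 c \<delta> + c\<^sup>2) |x|\<^sup>2\<close>, and the factor is below \<open>c\<^sup>2\<close> for large \<open>c\<close>; the choice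
  \<open>c = L\<^sup>2 / \<delta>\<close> turns it into \<open>c\<^sup>2 - L\<^sup>2\<close>.

  The disk bounds the operator norm and not only the numerical range. The stronger form is needed
  because operator norm disks, unlike disks around numerical ranges, are preserved by the Moebius
  map that leads from \<open>D\<close> to \<open>E\<close>.
\<close>

lemma pos_def_in_disk:
  fixes D :: "real^'n^'n"
  assumes "pos_def D"
  obtains c \<rho> where "0 < \<rho>" "\<rho> < c" "\<And>x. norm (D *v x - c *\<^sub>R x) \<le> \<rho> * norm x"
proof -
  have "norm (axis undefined 1 :: real^'n) = 1" by simp
  then have ne: "sphere (0 :: real^'n) 1 \<noteq> {}" by (metis empty_iff mem_sphere_0)
  have "continuous_on (sphere 0 1) (\<lambda>x. x \<bullet> (D *v x))"
    by (intro continuous_intros matrix_vector_mult_linear_continuous_on)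
  then obtain x0 where x0: "x0 \<in> sphere 0 1" "\<And>x. x \<in> sphere 0 1 \<Longrightarrow> x0 \<bullet> (D *v x0) \<le> x \<bullet> (D *v x)"
    using continuous_attains_inf[OF compact_sphere ne] by metis
  define \<delta> where "\<delta> = x0 \<bullet> (D *v x0)"
  have "x0 \<noteq> 0" using x0(1) by auto
  then have \<delta>: "\<delta> > 0" using assms unfolding \<delta>_def pos_def_def by blast
  have lower: "\<delta> * (norm x)\<^sup>2 \<le> x \<bullet> (D *v x)" for x
  proof (cases "x = 0")
    case False
    define y where "y = (1 / norm x) *\<^sub>R x"
    have x: "x = norm x *\<^sub>R y" using False by (simp add: y_def)
    have "\<delta> \<le> y \<bullet> (D *v y)" using x0(2)[of y] False by (simp add: y_def \<delta>_def)
    then have "\<delta> * (norm x)\<^sup>2 \<le> (y \<bullet> (D *v y)) * (norm x)\<^sup>2" by (rule mult_right_mono) simp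
    also have "\<dots> = (norm x *\<^sub>R y) \<bullet> (D *v (norm x *\<^sub>R y))"
      by (simp add: matrix_vector_mult_scaleR power2_eq_square)
    finally show ?thesis using x by simp
  qed simp
  obtain K where K: "K > 0" "\<And>x. norm (D *v x) \<le> K * norm x"
    using linear_bounded_pos[OF matrix_vector_mul_linear[of D]] by (metis mult.commute)
  \<comment> \<open>\<open>L > \<delta>\<close> ensures \<open>c = L\<^sup>2 / \<delta> > L\<close>, which makes the radius positive.\<close>
  define L where "L = K + \<delta>"
  define c where "c = L\<^sup>2 / \<delta>"
  define \<rho> where "\<rho> = sqrt (c\<^sup>2 - L\<^sup>2)"
  have L: "L > \<delta>" "L > K" "L > 0" using K \<delta> by (auto simp: L_def)
  have "c * \<delta> > L * \<delta>" using L \<delta> by (simp add: c_def power2_eq_square)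
  then have cL: "c > L" using \<delta> by simp
  have pos: "c\<^sup>2 - L\<^sup>2 > 0" using cL L by (simp add: power_strict_mono)
  show thesis
  proof (rule that)
    show "0 < \<rho>" using pos by (simp add: \<rho>_def)
    have "\<rho> < sqrt (c\<^sup>2)" unfolding \<rho>_def using L by (intro real_sqrt_less_mono) simp
    then show "\<rho> < c" using cL L by simp
    fix x
    have "(norm (D *v x - c *\<^sub>R x))\<^sup>2 = (norm (D *v x))\<^sup>2 - 2 * c * (x \<bullet> (D *v x)) + c\<^sup>2 * (norm x)\<^sup>2"
      unfolding power2_norm_eq_inner
      by (simp add: inner_diff_left inner_diff_right inner_commute algebra_simps power2_eq_square)
    also have "\<dots> \<le> L\<^sup>2 * (norm x)\<^sup>2 - 2 * c * (\<delta> * (norm x)\<^sup>2) + c\<^sup>2 * (norm x)\<^sup>2"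
    proof -
      have "norm (D *v x) \<le> L * norm x" using K(2)[of x] L(2) by (meson mult_right_mono norm_ge_zero less_imp_le order_trans)
      then have "(norm (D *v x))\<^sup>2 \<le> L\<^sup>2 * (norm x)\<^sup>2" by (metis norm_ge_zero power_mono power_mult_distrib)
      moreover have "2 * c * (\<delta> * (norm x)\<^sup>2) \<le> 2 * c * (x \<bullet> (D *v x))"
        using lower[of x] cL L by (intro mult_left_mono) auto
      ultimately show ?thesis by linarith
    qed
    also have "\<dots> = (c\<^sup>2 - L\<^sup>2) * (norm x)\<^sup>2" using \<delta> by (simp add: c_def field_simps)
    also have "\<dots> = (\<rho> * norm x)\<^sup>2" using pos by (simp add: \<rho>_def power_mult_distrib)
    finally show "norm (D *v x - c *\<^sub>R x) \<le> \<rho> * norm x"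
      by (rule power2_le_imp_le) (use \<open>0 < \<rho>\<close> in simp)
  qed
qed

section \<open>Disks under the map from \<open>B\<close> to \<open>S\<close>\<close>

lemma g_map_eq: "\<mu> > 0 \<Longrightarrow> g_map \<gamma> \<mu> = \<mu> / (\<mu> + \<gamma>)" if "\<gamma> > 0"
  using that by (simp add: g_map_def field_simps)

text \<open>
  The upper limit \<open>1\<close> is the value of \<open>g\<close> at infinity. It keeps the eigenvalue \<open>1\<close> out of the disk, and it gives \<open>r < 1\<close> for the radii of the error bound.
\<close>

lemma S_disk:
  assumes "\<gamma> > 0" "0 < \<rho>" "\<rho> < c"
  shows "0 < S_radius \<gamma> c \<rho>" "S_radius \<gamma> c \<rho> < S_center \<gamma> c \<rho>"
    "S_center \<gamma> c \<rho> + S_radius \<gamma> c \<rho> < 1"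
proof -
  have g: "g_map \<gamma> (c - \<rho>) = (c - \<rho>) / (c - \<rho> + \<gamma>)" "g_map \<gamma> (c + \<rho>) = (c + \<rho>) / (c + \<rho> + \<gamma>)"
    using assms by (simp_all add: g_map_eq)
  have "g_map \<gamma> (c - \<rho>) < g_map \<gamma> (c + \<rho>)"
  proof -
    have "\<gamma> / (c + \<rho> + \<gamma>) < \<gamma> / (c - \<rho> + \<gamma>)" using assms by (intro divide_strict_left_mono) auto
    moreover have "\<mu> / (\<mu> + \<gamma>) = 1 - \<gamma> / (\<mu> + \<gamma>)" if "\<mu> > 0" for \<mu>
      using that assms(1) by (simp add: field_simps)
    ultimately show ?thesis unfolding g using assms by simp
  qed
  then show "0 < S_radius \<gamma> c \<rho>" by (simp add: S_radius_def)
  have "0 < g_map \<gamma> (c - \<rho>)" unfolding g using assms by simp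
  then show "S_radius \<gamma> c \<rho> < S_center \<gamma> c \<rho>" by (simp add: S_radius_def S_center_def field_simps)
  have "g_map \<gamma> (c + \<rho>) < 1" unfolding g using assms by simp
  then show "S_center \<gamma> c \<rho> + S_radius \<gamma> c \<rho> < 1" by (simp add: S_radius_def S_center_def field_simps)
qed

text \<open>
  In this form a disk is described by the two real end points of its diameter, which a Moebius map with real coefficients simply maps to the new end points.
\<close>

lemma norm_disk_iff:
  fixes p q :: "'a :: real_inner"
  assumes "\<rho> \<ge> 0"
  shows "norm (p - c *\<^sub>R q) \<le> \<rho> * norm q \<longleftrightarrow> (p - (c - \<rho>) *\<^sub>R q) \<bullet> (p - (c + \<rho>) *\<^sub>R q) \<le> 0"
proof -
  have "norm (p - c *\<^sub>R q) \<le> \<rho> * norm q \<longleftrightarrow> (norm (p - c *\<^sub>R q))\<^sup>2 \<le> (\<rho> * norm q)\<^sup>2"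
    using assms by (simp add: power_mono_iff)
  also have "(norm (p - c *\<^sub>R q))\<^sup>2 - (\<rho> * norm q)\<^sup>2 = (p - (c - \<rho>) *\<^sub>R q) \<bullet> (p - (c + \<rho>) *\<^sub>R q)"
    unfolding power_mult_distrib power2_norm_eq_inner
    by (simp add: inner_diff_left inner_diff_right inner_commute algebra_simps power2_eq_square)
  then have "(norm (p - c *\<^sub>R q))\<^sup>2 \<le> (\<rho> * norm q)\<^sup>2 \<longleftrightarrow> (p - (c - \<rho>) *\<^sub>R q) \<bullet> (p - (c + \<rho>) *\<^sub>R q) \<le> 0"
    by linarith
  finally show ?thesis .
qed

text \<open>
  Write \<open>x = (D + \<gamma>) z\<close>, so that \<open>E x = D z\<close>. For each end point \<open>\<mu>\<close> of the diameter,
  \<open>E x - g(\<mu>) x\<close> is the positive multiple \<open>\<gamma> / (\<mu> + \<gamma>)\<close> of \<open>D z - \<mu> z\<close>, so the inequality that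
  describes the disk for \<open>D\<close> at \<open>z\<close> becomes the one for \<open>E\<close> at \<open>x\<close>.
\<close>

lemma mobius_disk:
  fixes D E :: "real^'n^'n"
  assumes "\<gamma> > 0" "0 < \<rho>" "\<rho> < c" and D: "\<And>x. norm (D *v x - c *\<^sub>R x) \<le> \<rho> * norm x"
    and E: "E ** (D + \<gamma> *\<^sub>R mat 1) = D" and inv: "invertible (D + \<gamma> *\<^sub>R mat 1)"
  shows "norm (E *v x - S_center \<gamma> c \<rho> *\<^sub>R x) \<le> S_radius \<gamma> c \<rho> * norm x"
proof -
  define z where "z = matrix_inv (D + \<gamma> *\<^sub>R mat 1) *v x"
  have "x = (D + \<gamma> *\<^sub>R mat 1) *v z" by (simp add: z_def matrix_vector_mul_assoc matrix_inv_right[OF inv])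
  then have x: "x = D *v z + \<gamma> *\<^sub>R z" and Ex: "E *v x = D *v z"
    by (simp_all only: matrix_vector_mul_assoc E)
      (simp add: matrix_vector_mult_add_rdistrib flip: scaleR_matrix_vector_assoc)
  have step: "D *v z - g_map \<gamma> \<mu> *\<^sub>R x = (\<gamma> / (\<mu> + \<gamma>)) *\<^sub>R (D *v z - \<mu> *\<^sub>R z)" if "\<mu> > 0" for \<mu>
  proof -
    define q where "q = g_map \<gamma> \<mu>"
    have q: "\<gamma> / (\<mu> + \<gamma>) = 1 - q" "q * \<gamma> = (1 - q) * \<mu>"
      using that assms(1) by (simp_all add: q_def g_map_eq field_simps)
    have "D *v z - q *\<^sub>R x = (1 - q) *\<^sub>R (D *v z) - (q * \<gamma>) *\<^sub>R z"
      unfolding x by (simp add: algebra_simps)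
    also have "\<dots> = (1 - q) *\<^sub>R (D *v z - \<mu> *\<^sub>R z)" by (simp add: q(2) scaleR_diff_right)
    finally show ?thesis unfolding q(1) q_def .
  qed
  have ends: "S_center \<gamma> c \<rho> - S_radius \<gamma> c \<rho> = g_map \<gamma> (c - \<rho>)" "S_center \<gamma> c \<rho> + S_radius \<gamma> c \<rho> = g_map \<gamma> (c + \<rho>)"
    by (simp_all add: S_center_def S_radius_def field_simps)
  have "(D *v z - (c - \<rho>) *\<^sub>R z) \<bullet> (D *v z - (c + \<rho>) *\<^sub>R z) \<le> 0"
    using D[of z] assms(2) by (simp add: norm_disk_iff)
  then have "(\<gamma> / (c + \<rho> + \<gamma>)) * ((\<gamma> / (c - \<rho> + \<gamma>)) * ((D *v z - (c - \<rho>) *\<^sub>R z) \<bullet> (D *v z - (c + \<rho>) *\<^sub>R z))) \<le> 0"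
    using assms by (intro mult_nonneg_nonpos) auto
  then have "(D *v z - g_map \<gamma> (c - \<rho>) *\<^sub>R x) \<bullet> (D *v z - g_map \<gamma> (c + \<rho>) *\<^sub>R x) \<le> 0"
    using step[of "c - \<rho>"] step[of "c + \<rho>"] assms(2,3)
    by (simp only: inner_scaleR_left inner_scaleR_right)
  then show ?thesis
    using S_disk(1)[OF assms(1-3)] by (subst norm_disk_iff) (simp_all add: ends Ex)
qed

section \<open>Matrix functions and similarity\<close>

lemma mpow_similar:
  assumes "P ** R = mat 1"
  shows "mpow (R ** Z ** P) k = R ** mpow Z k ** (P :: real^'n^'n)"
proof (induction k)
  case 0
  have "R ** P = mat 1" using assms matrix_left_right_inverse by blast
  then show ?case by simp
next
  case (Suc k)
  have "mpow (R ** Z ** P) (Suc k) = R ** Z ** (P ** R) ** mpow Z k ** P"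
    by (simp add: Suc matrix_mul_assoc)
  then show ?case by (simp add: assms matrix_mul_assoc)
qed

lemma mexp_summable:
  fixes Z :: "real^'n^'n"
  shows "summable (\<lambda>k. (1 / fact k) *\<^sub>R mpow Z k)"
proof -
  obtain K where K: "K > 0" "\<And>A B. norm ((A :: real^'n^'n) ** (B :: real^'n^'n)) \<le> norm A * norm B * K"
    using bounded_bilinear.pos_bounded[OF bounded_bilinear_matrix_mult] by metis
  have le: "norm (mpow Z k) \<le> norm (mat 1 :: real^'n^'n) * (norm Z * K) ^ k" for k
  proof (induction k)
    case (Suc k)
    have "norm (mpow Z (Suc k)) \<le> norm Z * K * norm (mpow Z k)" using K(2)[of Z "mpow Z k"] by (simp add: mult_ac)
    also have "\<dots> \<le> norm Z * K * (norm (mat 1 :: real^'n^'n) * (norm Z * K) ^ k)"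
      using Suc K(1) by (intro mult_left_mono) auto
    finally show ?case by (simp add: mult_ac)
  qed simp
  have "summable (\<lambda>k. norm (mat 1 :: real^'n^'n) * (inverse (fact k) * (norm Z * K) ^ k))"
    by (rule summable_mult[OF summable_exp])
  then show ?thesis
  proof (rule summable_comparison_test'[of _ 0])
    fix k
    have "inverse (fact k) * norm (mpow Z k) \<le> inverse (fact k) * (norm (mat 1 :: real^'n^'n) * (norm Z * K) ^ k)"
      by (rule mult_left_mono[OF le]) simp
    then show "norm ((1 / fact k) *\<^sub>R mpow Z k) \<le> norm (mat 1 :: real^'n^'n) * (inverse (fact k) * (norm Z * K) ^ k)"
      by (simp add: divide_inverse mult_ac)
  qed
qed

lemma mexp_similar:
  assumes "P ** R = mat 1"
  shows "mexp (R ** Z ** P) = R ** mexp Z ** (P :: real^'n^'n)"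
proof -
  have "R ** mexp Z ** P = (\<Sum>k. R ** ((1 / fact k) *\<^sub>R mpow Z k) ** P)"
    unfolding mexp_def
    using bounded_linear.suminf[OF bounded_linear_compose[OF matmul.bounded_linear_left[of P] matmul.bounded_linear_right[of R]] mexp_summable[of Z]]
    by simp
  then show ?thesis by (simp add: mexp_def mpow_similar[OF assms] matmul.scaleR_left matmul.scaleR_right)
qed

lemma matrix_inv_similar:
  assumes "P ** R = mat 1" "invertible Z"
  shows "invertible (R ** Z ** (P :: real^'n^'n))" "matrix_inv (R ** Z ** P) = R ** matrix_inv Z ** P"
proof -
  have RP: "R ** P = mat 1" using assms(1) matrix_left_right_inverse by blast
  have "R ** Z ** P ** (R ** matrix_inv Z ** P) = R ** (Z ** (P ** R) ** matrix_inv Z) ** P"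
    by (simp add: matrix_mul_assoc)
  also have "\<dots> = mat 1" by (simp add: assms matrix_inv_right RP)
  finally have *: "R ** Z ** P ** (R ** matrix_inv Z ** P) = mat 1" .
  show "invertible (R ** Z ** P)" "matrix_inv (R ** Z ** P) = R ** matrix_inv Z ** P"
    using invertibleI[OF *] .
qed

lemma mphi_similar:
  assumes PR: "P ** R = mat 1" and Z: "k = 0 \<or> invertible Z"
  shows "mphi k (R ** Z ** P) = R ** mphi k Z ** (P :: real^'n^'n)"
  using Z
proof (induction k)
  case 0
  then show ?case by (simp add: mexp_similar[OF PR])
next
  case (Suc k)
  then have inv: "invertible Z" by simp
  have RP: "R ** P = mat 1" using PR matrix_left_right_inverse by blast
  have "mphi (Suc k) (R ** Z ** P) = (R ** mphi k Z ** P - (1 / fact k) *\<^sub>R (R ** P)) ** (R ** matrix_inv Z ** P)"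
    using Suc by (simp add: matrix_inv_similar[OF PR inv] RP)
  also have "R ** mphi k Z ** P - (1 / fact k) *\<^sub>R (R ** P) = R ** (mphi k Z - (1 / fact k) *\<^sub>R mat 1) ** P"
    by (simp add: matmul.diff_left matmul.diff_right matmul.scaleR_left matmul.scaleR_right)
  also have "\<dots> ** (R ** matrix_inv Z ** P) = R ** (mphi k Z - (1 / fact k) *\<^sub>R mat 1) ** (P ** R) ** matrix_inv Z ** P"
    by (simp only: matrix_mul_assoc)
  finally show ?case by (simp add: PR matrix_mul_assoc)
qed

section \<open>Numerical ranges and disks\<close>

lemma herm_scale_left: "herm (c *s x) y = cnj c * herm x y"
  unfolding herm_def by (simp add: sum_distrib_left mult_ac)

lemma herm_cauchy_schwarz: "cmod (herm x y) \<le> norm x * norm y"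
proof -
  have "cmod (herm x y) \<le> (\<Sum>i\<in>UNIV. \<bar>cmod (x $ i)\<bar> * \<bar>cmod (y $ i)\<bar>)"
    unfolding herm_def by (rule order_trans[OF norm_sum]) (simp add: norm_mult)
  also have "\<dots> \<le> norm x * norm y" unfolding norm_vec_def by (rule L2_set_mult_ineq)
  finally show ?thesis .
qed

lemma cmat_shift: "cmat (A - c *\<^sub>R mat 1) *v w = cmat A *v w - of_real c *s w"
proof -
  obtain a b where w: "w = cvec a b" by (rule cvec_surj)
  show ?thesis unfolding w cmat_cvec
    by (simp add: matrix_vector_mult_diff_rdistrib cvec_def vec_eq_iff complex_eq_iff flip: scaleR_matrix_vector_assoc)
qed

definition numrange :: "real^'n^'n \<Rightarrow> complex set" where
  "numrange A = {herm w (cmat A *v w) |w. norm w = 1}"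

lemma num_radius_le_if_numrange:
  assumes "numrange A \<subseteq> cball (of_real c) \<rho>"
  shows "num_radius_le (A - c *\<^sub>R mat 1) \<rho>"
  unfolding num_radius_le_def
proof
  fix w :: "complex^'a"
  show "cmod (herm w (cmat (A - c *\<^sub>R mat 1) *v w)) \<le> \<rho> * (norm w)\<^sup>2"
  proof (cases "w = 0")
    case False
    define v where "v = (1 / norm w) *\<^sub>R w"
    have w: "w = of_real (norm w) *s v"
      using False by (simp add: v_def vec_eq_iff) (simp add: scaleR_conv_of_real)
    have herm: "herm w (cmat A *v w) = of_real ((norm w)\<^sup>2) * herm v (cmat A *v v)"
      by (subst (1 2) w) (simp add: herm_scale_left herm_scale_right
          vector_scalar_commute power2_eq_square mult_ac)
    have "norm v = 1" using False by (simp add: v_def)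
    then have "cmod (of_real c - herm v (cmat A *v v)) \<le> \<rho>"
      using assms unfolding numrange_def by (auto simp: dist_norm)
    moreover have "herm w (cmat (A - c *\<^sub>R mat 1) *v w) = of_real ((norm w)\<^sup>2) * (herm v (cmat A *v v) - of_real c)"
      by (simp add: cmat_shift herm_diff_right herm_scale_right herm_self herm algebra_simps)
    ultimately show ?thesis
      using mult_right_mono[of "cmod (of_real c - herm v (cmat A *v v))" \<rho> "(norm w)\<^sup>2"]
      by (simp add: norm_mult norm_minus_commute mult.commute norm_power)
  qed (simp add: herm_def)
qed

lemma numrange_in_disk:
  assumes "\<And>x. norm (A *v x - c *\<^sub>R x) \<le> \<rho> * norm x" "\<rho> \<ge> 0"
  shows "numrange A \<subseteq> cball (of_real c) \<rho>"
proof
  fix u assume "u \<in> numrange A"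
  then obtain w where w: "u = herm w (cmat A *v w)" "norm w = 1" unfolding numrange_def by blast
  obtain a b where ab: "w = cvec a b" by (rule cvec_surj)
  define T where "T = A - c *\<^sub>R mat 1"
  have T: "norm (T *v x) \<le> \<rho> * norm x" for x
    using assms(1)[of x] by (simp add: T_def matrix_vector_mult_diff_rdistrib flip: scaleR_matrix_vector_assoc)
  have "(norm (cmat T *v w))\<^sup>2 = (norm (T *v a))\<^sup>2 + (norm (T *v b))\<^sup>2" by (simp add: ab cmat_cvec norm_cvec)
  also have "\<dots> \<le> (\<rho> * norm a)\<^sup>2 + (\<rho> * norm b)\<^sup>2" by (intro add_mono power_mono T) auto
  also have "\<dots> = \<rho>\<^sup>2 * (norm w)\<^sup>2" by (simp add: ab norm_cvec power_mult_distrib algebra_simps)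
  finally have "(norm (cmat T *v w))\<^sup>2 \<le> \<rho>\<^sup>2" using w(2) by simp
  then have "norm (cmat T *v w) \<le> \<rho>" using assms(2) by (rule power2_le_imp_le)
  moreover have "u - of_real c = herm w (cmat T *v w)"
    using w by (simp add: T_def cmat_shift herm_diff_right herm_scale_right herm_self)
  moreover have "cmod (herm w (cmat T *v w)) \<le> norm (cmat T *v w)"
    using herm_cauchy_schwarz[of w "cmat T *v w"] w(2) by simp
  ultimately show "u \<in> cball (of_real c) \<rho>" by (simp add: dist_norm norm_minus_commute)
qed

lemma zero_notin_numrange:
  assumes "pos_def A" shows "0 \<notin> numrange A"
proof
  assume "0 \<in> numrange A"
  then obtain w where w: "herm w (cmat A *v w) = 0" "norm w = 1" unfolding numrange_def by auto
  obtain a b where ab: "w = cvec a b" by (rule cvec_surj)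
  have nonneg: "0 \<le> x \<bullet> (A *v x)" for x
    using assms unfolding pos_def_def by (cases "x = 0") (auto intro: less_imp_le)
  have "a \<bullet> (A *v a) + b \<bullet> (A *v b) = 0" using w(1) by (simp add: ab cmat_cvec herm_cvec complex_eq_iff)
  then have "a \<bullet> (A *v a) = 0" "b \<bullet> (A *v b) = 0" using nonneg[of a] nonneg[of b] by linarith+
  then have "a = 0" "b = 0" using assms unfolding pos_def_def by (metis less_irrefl)+
  then show False using w(2) norm_cvec[of a b] by (simp add: ab)
qed

text \<open>
  Yields \<open>C\<^sub>1\<^sup>1\<^sup>/\<^sup>2\<close> and its inverse, which turn the \<open>C\<close>-norm into a Euclidean norm.
\<close>

lemma diagonal_sqrt:
  fixes C1 :: "real^'r^'r"
  assumes "\<And>i j. i \<noteq> j \<Longrightarrow> C1 $ i $ j = 0" "\<And>i. C1 $ i $ i > 0"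
  obtains L Li where "transpose L = L" "L ** L = C1" "L ** Li = mat 1"
proof
  define diag :: "('r \<Rightarrow> real) \<Rightarrow> real^'r^'r" where "diag d = (\<chi> i j. if i = j then d i else 0)" for d
  have mult: "diag d ** diag e = diag (\<lambda>i. d i * e i)" for d e
  proof -
    have "(if i = k then d i else 0) * (if k = j then e k else 0)
        = (if k = i then if i = j then d i * e i else 0 else 0)" for i j k by simp
    then show ?thesis by (simp add: diag_def matrix_matrix_mult_def vec_eq_iff)
  qed
  show "transpose (diag (\<lambda>i. sqrt (C1 $ i $ i))) = diag (\<lambda>i. sqrt (C1 $ i $ i))"
    by (simp add: transpose_def diag_def vec_eq_iff)
  show "diag (\<lambda>i. sqrt (C1 $ i $ i)) ** diag (\<lambda>i. sqrt (C1 $ i $ i)) = C1"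
    using assms less_imp_le[OF assms(2)] unfolding mult by (simp add: diag_def vec_eq_iff)
  show "diag (\<lambda>i. sqrt (C1 $ i $ i)) ** diag (\<lambda>i. 1 / sqrt (C1 $ i $ i)) = mat 1"
    using assms(2) unfolding mult by (simp add: diag_def mat_def vec_eq_iff less_imp_neq[symmetric])
qed

section \<open>Reduction to coordinates on the range of \<open>C\<close>\<close>

text \<open>
  \<open>L\<close> stands for \<open>C\<^sub>1\<^sup>1\<^sup>/\<^sup>2\<close>. The map \<open>x \<mapsto> U\<^sup>T x\<close> with \<open>U = V L\<close> is an isometry from the range of \<open>C\<close>
  with the \<open>C\<close>-norm onto Euclidean space. In these coordinates \<open>B\<close> becomes \<open>D\<close>, which is positive
  definite, and \<open>S\<close> becomes \<open>E = D (D + \<gamma>)\<^sup>-\<^sup>1\<close>.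
\<close>

locale reduced_pencil =
  fixes C G :: "real^'n^'n" and V :: "real^'r^'n" and L Li :: "real^'r^'r" and \<gamma> :: real
  assumes C_psd: "\<And>v. 0 \<le> v \<bullet> (C *v v)" and G: "pos_def G" and \<gamma>: "\<gamma> > 0"
    and L_sym: "transpose L = L" and L_inv: "L ** Li = mat 1"
    and V_orth: "transpose V ** V = mat 1" and C_eq: "C = V ** (L ** L) ** transpose V"
begin

definition "U = V ** L"
definition "D = transpose U ** matrix_inv G ** U"
definition "E = transpose U ** matrix_inv (C + \<gamma> *\<^sub>R G) ** U"

lemma U_transpose: "transpose U = L ** transpose V"
  by (simp add: U_def matrix_transpose_mul L_sym)

lemma C_factor: "C = U ** transpose U"
  by (simp add: C_eq U_transpose) (simp add: U_def matrix_mul_assoc)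

lemma Ut_V: "transpose U ** V = L"
  by (simp add: U_transpose V_orth flip: matrix_mul_assoc)

lemma Ut_proj: "transpose U ** (V ** transpose V) = transpose U"
  by (simp add: matrix_mul_assoc Ut_V) (simp add: U_transpose)

lemma Ut_section: "transpose U ** (V ** Li) = mat 1"
  by (simp add: matrix_mul_assoc Ut_V L_inv)

lemma Li_L: "Li ** L = mat 1"
  using L_inv matrix_left_right_inverse by blast

lemma Li_Ut: "Li ** transpose U = transpose V"
  by (simp add: U_transpose matrix_mul_assoc Li_L)

lemma U_injective:
  assumes "U *v x = 0" shows "x = 0"
proof -
  have "(Li ** (transpose V ** U)) *v x = 0" using assms by (simp flip: matrix_vector_mul_assoc)
  moreover have "Li ** (transpose V ** U) = mat 1"
    by (simp add: U_def matrix_mul_assoc V_orth) (simp add: V_orth Li_L flip: matrix_mul_assoc)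
  ultimately show ?thesis by simp
qed

lemma C_norm_eq: "C_norm C x = norm (transpose U *v x)"
proof -
  have "x \<bullet> (C *v x) = (transpose U *v x) \<bullet> (transpose U *v x)"
    using inner_transpose_matrix[of x "transpose U" "transpose U *v x"]
    by (simp add: C_factor matrix_vector_mul_assoc)
  then show ?thesis by (simp add: C_norm_def norm_eq_sqrt_inner)
qed

lemma D_pos_def: "pos_def D"
  unfolding D_def by (rule pos_def_compress[OF pos_def_matrix_inv[OF G] U_injective])

lemma D_inv: "invertible D" by (rule pos_def_invertible[OF D_pos_def])

lemma D_shift_inv: "invertible (D + \<gamma> *\<^sub>R mat 1)"
proof -
  have "0 \<le> v \<bullet> (D *v v)" for v
    using D_pos_def unfolding pos_def_def by (cases "v = 0") (auto intro: less_imp_le)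
  moreover have "pos_def (mat 1 :: real^'r^'r)" unfolding pos_def_def by simp
  ultimately show ?thesis using pos_def_add_scaled[OF _ _ \<gamma>] pos_def_invertible by blast
qed

text \<open>
  From \<open>C = U U\<^sup>T\<close> one gets \<open>(C + \<gamma> G) G\<^sup>-\<^sup>1 U = U (D + \<gamma>)\<close>; multiplying by \<open>U\<^sup>T (C + \<gamma> G)\<^sup>-\<^sup>1\<close> gives the claim.
\<close>

lemma E_D: "E ** (D + \<gamma> *\<^sub>R mat 1) = D"
proof -
  define R where "R = matrix_inv (C + \<gamma> *\<^sub>R G)"
  have RR: "R ** (C + \<gamma> *\<^sub>R G) = mat 1"
    unfolding R_def by (rule matrix_inv_left[OF pos_def_invertible[OF pos_def_add_scaled[OF C_psd G \<gamma>]]])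
  have GG: "G ** matrix_inv G = mat 1" by (rule matrix_inv_right[OF pos_def_invertible[OF G]])
  have "U ** (D + \<gamma> *\<^sub>R mat 1) = (C + \<gamma> *\<^sub>R G) ** (matrix_inv G ** U)"
    by (simp add: matmul.add_left matmul.add_right matmul.scaleR_left matmul.scaleR_right matrix_mul_assoc GG)
      (simp add: D_def C_factor matrix_mul_assoc)
  then have "transpose U ** R ** (U ** (D + \<gamma> *\<^sub>R mat 1)) = transpose U ** (R ** (C + \<gamma> *\<^sub>R G)) ** (matrix_inv G ** U)"
    by (simp add: matrix_mul_assoc)
  then show ?thesis by (simp add: RR) (simp add: E_def D_def R_def matrix_mul_assoc)
qed

text \<open>
  This identity is the reason why \<open>f\<close> and \<open>f\<^sub>k\<close> evaluated at \<open>S\<close> reproduce the projected solution, which is written with the inverse of \<open>B\<^sub>1\<^sub>1\<close>.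
\<close>

lemma g1_inv_mat_E: "g1_inv_mat \<gamma> E = matrix_inv D"
proof -
  have "E ** ((D + \<gamma> *\<^sub>R mat 1) ** matrix_inv D) = mat 1"
    by (simp add: matrix_mul_assoc E_D matrix_inv_right[OF D_inv])
  then have "matrix_inv E = (D + \<gamma> *\<^sub>R mat 1) ** matrix_inv D" by (rule invertibleI)
  then show ?thesis
    using \<gamma> by (simp add: g1_inv_mat_def matmul.add_left matmul.scaleR_left matrix_inv_right[OF D_inv])
qed

text \<open>
  \<open>x \<mapsto> U\<^sup>T x\<close> maps the complex \<open>C\<close>-unit sphere onto the Euclidean unit sphere, with right inverse \<open>V L\<^sup>-\<^sup>1\<close>.
\<close>

lemma C_numrange_eq:
  assumes "C ** M = U ** X ** transpose U"
  shows "C_numrange C M = numrange X"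
proof -
  have norm: "C_norm_complex C (cvec a b) = norm (cvec (transpose U *v a) (transpose U *v b))" for a b
  proof -
    have "Re (herm (cvec a b) (cmat C *v cvec a b)) = (C_norm C a)\<^sup>2 + (C_norm C b)\<^sup>2"
      using C_psd by (simp add: cmat_cvec herm_cvec C_norm_def)
    then show ?thesis
      by (simp add: C_norm_complex_def C_norm_eq real_sqrt_unique norm_cvec[symmetric])
  qed
  have val: "herm (cvec a b) (cmat (C ** M) *v cvec a b)
      = herm (cvec (transpose U *v a) (transpose U *v b)) (cmat X *v cvec (transpose U *v a) (transpose U *v b))" for a b
  proof -
    have "x \<bullet> ((C ** M) *v y) = (transpose U *v x) \<bullet> (X *v (transpose U *v y))" for x y
      using inner_transpose_matrix[of x "transpose U" "X *v (transpose U *v y)"]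
      by (simp add: assms flip: matrix_vector_mul_assoc)
    then show ?thesis by (simp add: cmat_cvec herm_cvec)
  qed
  show ?thesis
  proof (intro equalityI subsetI)
    fix u assume "u \<in> C_numrange C M"
    then obtain x where x: "u = herm x (cmat (C ** M) *v x)" "C_norm_complex C x = 1"
      unfolding C_numrange_def by blast
    obtain a b where "x = cvec a b" by (rule cvec_surj)
    then show "u \<in> numrange X" using x norm val unfolding numrange_def by auto
  next
    fix u assume "u \<in> numrange X"
    then obtain w where w: "u = herm w (cmat X *v w)" "norm w = 1" unfolding numrange_def by blast
    obtain p q where pq: "w = cvec p q" by (rule cvec_surj)
    define x where "x = cvec ((V ** Li) *v p) ((V ** Li) *v q)"
    have "transpose U *v ((V ** Li) *v p) = p" for p
      by (simp only: matrix_vector_mul_assoc Ut_section matrix_vector_mul_lid)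
    then have "u = herm x (cmat (C ** M) *v x)" "C_norm_complex C x = 1"
      using w unfolding x_def norm val pq by simp_all
    then show "u \<in> C_numrange C M" unfolding C_numrange_def by blast
  qed
qed

lemma B_numrange: "C_numrange C (B_mat C G) = numrange D"
  by (rule C_numrange_eq) (simp add: B_mat_def D_def C_factor matrix_mul_assoc)

lemma Ut_S: "transpose U ** S_mat V C G \<gamma> = E ** transpose U"
proof -
  have "transpose U ** S_mat V C G \<gamma> = (transpose U ** (V ** transpose V)) ** matrix_inv (C + \<gamma> *\<^sub>R G) ** C"
    by (simp add: S_mat_def matrix_mul_assoc)
  also have "\<dots> = transpose U ** matrix_inv (C + \<gamma> *\<^sub>R G) ** (U ** transpose U)"
    by (simp add: Ut_proj C_factor[symmetric])
  finally show ?thesis by (simp add: E_def matrix_mul_assoc)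
qed

lemma S_numrange: "C_numrange C (S_mat V C G \<gamma>) = numrange E"
proof (rule C_numrange_eq)
  have "C ** S_mat V C G \<gamma> = U ** (transpose U ** S_mat V C G \<gamma>)"
    by (subst C_factor) (simp add: matrix_mul_assoc)
  then show "C ** S_mat V C G \<gamma> = U ** E ** transpose U" by (simp add: Ut_S matrix_mul_assoc)
qed

lemma zero_notin_B: "0 \<notin> C_numrange C (B_mat C G)"
  unfolding B_numrange by (rule zero_notin_numrange[OF D_pos_def])

lemma disks_exist:
  "\<exists>c1 \<rho>1. 0 < \<rho>1 \<and> \<rho>1 < c1 \<and>
     C_numrange C (B_mat C G) \<subseteq> cball (complex_of_real c1) \<rho>1 \<and>
     C_numrange C (S_mat V C G \<gamma>) \<subseteq> cball (complex_of_real (S_center \<gamma> c1 \<rho>1)) (S_radius \<gamma> c1 \<rho>1)"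
proof -
  obtain c \<rho> where c: "0 < \<rho>" "\<rho> < c" "\<And>x. norm (D *v x - c *\<^sub>R x) \<le> \<rho> * norm x"
    using pos_def_in_disk[OF D_pos_def] by metis
  have "numrange D \<subseteq> cball (of_real c) \<rho>" by (rule numrange_in_disk) (use c in auto)
  moreover have "numrange E \<subseteq> cball (of_real (S_center \<gamma> c \<rho>)) (S_radius \<gamma> c \<rho>)"
    using mobius_disk[OF \<gamma> c E_D D_shift_inv] S_disk(1)[OF \<gamma> c(1,2)] by (intro numrange_in_disk) auto
  ultimately show ?thesis using c unfolding B_numrange S_numrange by blast
qed

text \<open>
  \<open>B\<^sub>1\<^sub>1 = L\<^sup>-\<^sup>1 D L\<close>, so every matrix function of \<open>B\<^sub>1\<^sub>1\<close> is similar to the same function of \<open>D\<close>. For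
  \<open>t = 0\<close> the phi-functions of order 1 and 2 are multiplied by \<open>0\<close>.
\<close>

lemma x_proj_coordinates:
  assumes b0: "transpose V *v (matrix_inv G *v b0) = transpose V *v u0"
    and b1: "transpose V *v (matrix_inv G *v b1) = transpose V *v u1"
  shows "transpose U *v x_proj V C G x0 b0 b1 t =
    f0_mat \<gamma> t E *v (transpose U *v x0) + t *\<^sub>R (fk_mat 1 \<gamma> t E *v (transpose U *v u0))
    + t\<^sup>2 *\<^sub>R (fk_mat 2 \<gamma> t E *v (transpose U *v u1))"
proof -
  define X where "X = matrix_inv (B11_mat V C G)"
  have "B11_mat V C G = Li ** D ** L"
  proof -
    have "B11_mat V C G = transpose V ** matrix_inv G ** U ** (transpose U ** V)"
      by (simp add: B11_mat_def C_factor matrix_mul_assoc)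
    also have "\<dots> = (Li ** transpose U) ** matrix_inv G ** U ** L" by (simp only: Ut_V Li_Ut)
    finally show ?thesis by (simp add: D_def matrix_mul_assoc)
  qed
  then have X: "X = Li ** matrix_inv D ** L"
    using matrix_inv_similar(2)[OF L_inv D_inv] by (simp add: X_def)
  have tX: "- t *\<^sub>R X = Li ** (- t *\<^sub>R matrix_inv D) ** L"
    by (simp only: X matmul.scaleR_left matmul.scaleR_right)
  have phi: "mphi k (- t *\<^sub>R X) = Li ** mphi k (- t *\<^sub>R matrix_inv D) ** L" if "k = 0 \<or> t \<noteq> 0" for k
    unfolding tX
  proof (rule mphi_similar[OF L_inv])
    show "k = 0 \<or> invertible (- t *\<^sub>R matrix_inv D)"
    proof (cases "k = 0")
      case False
      then have "t \<noteq> 0" using that by simp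
      have "(- t *\<^sub>R matrix_inv D) ** ((- 1 / t) *\<^sub>R D) = mat 1"
        using \<open>t \<noteq> 0\<close> matrix_inv_left[OF D_inv]
        by (simp add: matmul.scaleR_left matmul.scaleR_right matmul.minus_left matmul.minus_right)
      then show ?thesis using invertibleI(1) by blast
    qed simp
  qed
  have UV: "transpose U *v (V *v y) = L *v y" for y by (simp add: matrix_vector_mul_assoc Ut_V)
  have LLi: "L *v (Li *v y) = y" for y by (simp add: matrix_vector_mul_assoc L_inv)
  have LV: "L *v (transpose V *v y) = transpose U *v y" for y by (simp add: matrix_vector_mul_assoc U_transpose)
  have t0: "transpose U *v ((V ** mexp (- t *\<^sub>R X) ** transpose V) *v x0) = f0_mat \<gamma> t E *v (transpose U *v x0)"
    using phi[of 0]
    by (simp add: UV LLi LV f0_mat_def g1_inv_mat_E flip: matrix_vector_mul_assoc)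
  have tk: "transpose U *v ((V ** X ** mphi k (- t *\<^sub>R X) ** transpose V ** matrix_inv G) *v b)
      = fk_mat k \<gamma> t E *v (transpose U *v u)"
    if "t \<noteq> 0" and b: "transpose V *v (matrix_inv G *v b) = transpose V *v u" for k b u
    using phi[of k] that(1)
    by (simp add: X UV LLi LV b fk_mat_def g1_inv_mat_E flip: matrix_vector_mul_assoc)
  show ?thesis
  proof (cases "t = 0")
    case True
    then show ?thesis using t0 by (simp add: x_proj_def Let_def X_def)
  next
    case False
    then show ?thesis using t0 tk[OF False b0, of 1] tk[OF False b1, of 2]
      by (simp only: x_proj_def Let_def X_def[symmetric] matrix_vector_right_distrib matrix_vector_mult_scaleR)
  qed
qed

lemma krylov_coordinates:
  "transpose U *v ((W ** F ** transpose W ** C) *v v)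
    = (transpose U ** W) *v (F *v (transpose (transpose U ** W) *v (transpose U *v v)))"
proof -
  have "transpose (transpose U ** W) ** transpose U = transpose W ** C"
    by (simp add: matrix_transpose_mul C_factor matrix_mul_assoc)
  then show ?thesis by (simp add: matrix_vector_mul_assoc matrix_mul_assoc) 
qed

text \<open>
  \<open>U\<^sup>T\<close> intertwines \<open>S\<close> with \<open>E\<close>, so an Arnoldi basis for \<open>S\<close> in the semi-inner product becomes a Euclidean one for \<open>E\<close>.
\<close>

lemma arnoldi_coordinates:
  fixes W :: "real^('m::{finite,linorder})^'n"
  assumes "arnoldi C (S_mat V C G \<gamma>) v W H"
  defines "Q \<equiv> transpose U ** W"
  shows "transpose Q ** Q = mat 1"
    "span (columns Q) = span {mpow E j *v (transpose U *v v) |j. j < CARD('m)}"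
    "H = transpose Q ** E ** Q"
proof -
  define S where "S = S_mat V C G \<gamma>"
  note A = assms(1)[unfolded arnoldi_def, folded S_def]
  have QT: "transpose Q = transpose W ** U" by (simp add: Q_def matrix_transpose_mul)
  have "transpose Q ** Q = transpose W ** (U ** transpose U) ** W"
    unfolding QT by (simp add: Q_def matrix_mul_assoc)
  then show "transpose Q ** Q = mat 1" using A by (simp add: C_factor[symmetric])
  have "H = transpose W ** (U ** transpose U) ** S ** W" using A by (simp add: C_factor[symmetric])
  then have "H = transpose W ** U ** (transpose U ** S) ** W" by (simp add: matrix_mul_assoc)
  then show "H = transpose Q ** E ** Q"
    unfolding S_def Ut_S QT by (simp add: Q_def matrix_mul_assoc)
  have pow: "transpose U *v (mpow S j *v v) = mpow E j *v (transpose U *v v)" for j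
  proof (induction j)
    case (Suc j)
    have "transpose U *v (mpow S (Suc j) *v v) = (transpose U ** S) *v (mpow S j *v v)"
      by (simp add: matrix_vector_mul_assoc matrix_mul_assoc)
    also have "\<dots> = E *v (transpose U *v (mpow S j *v v))"
      unfolding S_def Ut_S by (rule matrix_vector_mul_assoc[symmetric])
    also have "\<dots> = mpow E (Suc j) *v (transpose U *v v)" by (simp add: Suc) (simp add: matrix_vector_mul_assoc matrix_mul_assoc)
    finally show ?case .
  qed simp
  have "columns Q = (*v) (transpose U) ` columns W"
  proof -
    have "column i Q = transpose U *v column i W" for i
      unfolding Q_def by (simp add: matrix_vector_mult_basis[symmetric] matrix_vector_mul_assoc)
    then show ?thesis unfolding columns_def by auto
  qed
  then have "span (columns Q) = (*v) (transpose U) ` span (columns W)"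
    by (simp add: linear_span_image)
  also have "\<dots> = (*v) (transpose U) ` span {mpow S j *v v |j. j < CARD('m)}" using A by simp
  also have "\<dots> = span ((*v) (transpose U) ` {mpow S j *v v |j. j < CARD('m)})"
    by (rule linear_span_image[symmetric]) simp
  also have "(*v) (transpose U) ` {mpow S j *v v |j. j < CARD('m)} = {mpow E j *v (transpose U *v v) |j. j < CARD('m)}"
    using pow by (auto simp: image_iff) (metis)
  finally show "span (columns Q) = span {mpow E j *v (transpose U *v v) |j. j < CARD('m)}" .
qed

text \<open>
  For \<open>v = 0\<close> no Arnoldi basis is available, but both sides vanish. The functions \<open>F\<close> and \<open>F'\<close> stand for
  one matrix function at the two sizes \<open>r\<close> and \<open>m\<close>.
\<close>

lemma arnoldi_function_error:
  fixes W :: "real^('m::{finite,linorder})^'n"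
  assumes arn: "v \<noteq> 0 \<Longrightarrow> arnoldi C (S_mat V C G \<gamma>) v W H"
    and nr: "num_radius_le (E - c *\<^sub>R mat 1) \<rho>" and \<rho>: "0 < \<rho>" "\<rho> < c"
    and h: "h holomorphic_on ball 0 c"
    and F: "\<And>M :: real^'r^'r. num_radius_le (M - c *\<^sub>R mat 1) \<rho> \<Longrightarrow> F M = mat_fun h (M - c *\<^sub>R mat 1)"
    and F': "\<And>M :: real^('m::{finite,linorder})^('m::{finite,linorder}). num_radius_le (M - c *\<^sub>R mat 1) \<rho> \<Longrightarrow> F' M = mat_fun h (M - c *\<^sub>R mat 1)"
  shows "norm (F E *v (transpose U *v v) - transpose U *v ((W ** F' H ** transpose W ** C) *v v))
    \<le> 4 * C_norm C v * (\<Sum>j. cmod (taylor h (j + CARD('m))) * \<rho> ^ (j + CARD('m)))"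
proof (cases "v = 0")
  case True
  then show ?thesis by (simp add: C_norm_def)
next
  case False
  define Q where "Q = transpose U ** W"
  note Q = arnoldi_coordinates[OF arn[OF False], folded Q_def]
  have "H - c *\<^sub>R mat 1 = transpose Q ** (E - c *\<^sub>R mat 1) ** Q"
    by (simp add: Q(3) matmul.diff_left matmul.diff_right matmul.scaleR_left matmul.scaleR_right Q(1))
  then have nrH: "num_radius_le (H - c *\<^sub>R mat 1) \<rho>" using num_radius_le_compress[OF nr Q(1)] by simp
  show ?thesis
    unfolding krylov_coordinates F[OF nr] F'[OF nrH] C_norm_eq Q_def[symmetric]
    by (rule krylov_term_bound[OF nr \<rho> Q h taylor_summable[OF h \<rho>]])
qed

end

section \<open>The error bound\<close>

theorem theorem1:
  fixes C G :: "real^'n^'n" and V :: "real^'r^'n" and C1 :: "real^'r^'r"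
    and \<gamma> t :: real
    and x0 u0 u1 b0 b1 :: "real^'n"
    and W0 W1 W2 :: "real^('m::{finite,linorder})^'n"
    and H0 H1 H2 :: "real^('m::{finite,linorder})^('m::{finite,linorder})"
  defines "B \<equiv> B_mat C G"
    and "S \<equiv> S_mat V C G \<gamma>"
  assumes C: "sym_pos_semidef C"
    and G: "pos_def G"
    and gamma: "\<gamma> > 0"
    and V: "reduced_eigen_decomp C V C1"
    and x0: "x0 \<in> range ((*v) C)"
    and u0: "u0 \<in> range ((*v) C)"
    and u1: "u1 \<in> range ((*v) C)"
    and b0: "transpose V *v (matrix_inv G *v b0) = transpose V *v u0"
    and b1: "transpose V *v (matrix_inv G *v b1) = transpose V *v u1"
    and W0: "x0 \<noteq> 0 \<Longrightarrow> arnoldi C S x0 W0 H0"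
    and W1: "u0 \<noteq> 0 \<Longrightarrow> arnoldi C S u0 W1 H1"
    and W2: "u1 \<noteq> 0 \<Longrightarrow> arnoldi C S u1 W2 H2"
  shows "0 \<notin> C_numrange C B \<and>
    (\<exists>c1 \<rho>1. 0 < \<rho>1 \<and> \<rho>1 < c1 \<and>
       C_numrange C B \<subseteq> cball (complex_of_real c1) \<rho>1 \<and>
       C_numrange C S \<subseteq> cball (complex_of_real (S_center \<gamma> c1 \<rho>1)) (S_radius \<gamma> c1 \<rho>1)) \<and>
    (\<forall>c1 \<rho>1 c\<^sub>0 \<rho>\<^sub>0. 0 < \<rho>1 \<and> \<rho>1 < c1 \<and> c\<^sub>0 = S_center \<gamma> c1 \<rho>1 \<and> \<rho>\<^sub>0 = S_radius \<gamma> c1 \<rho>1 \<and>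
       C_numrange C B \<subseteq> cball (complex_of_real c1) \<rho>1 \<and>
       C_numrange C S \<subseteq> cball (complex_of_real c\<^sub>0) \<rho>\<^sub>0 \<longrightarrow>
       0 < \<rho>\<^sub>0 \<and> \<rho>\<^sub>0 < c\<^sub>0 \<and>
       (\<forall>r. \<rho>\<^sub>0 < r \<and> r < c\<^sub>0 \<longrightarrow>
          C_norm C (x_proj V C G x0 b0 b1 t - x_krylov C \<gamma> W0 H0 W1 H1 W2 H2 x0 u0 u1 t)
            \<le> (SUP z\<in>sphere (complex_of_real c\<^sub>0) r.
                   cmod (f0 \<gamma> t z) * C_norm C x0
                   + \<bar>t\<bar> * cmod (fk 1 \<gamma> t z) * C_norm C u0
                   + t\<^sup>2 * cmod (fk 2 \<gamma> t z) * C_norm C u1)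
                * (4 / (r - \<rho>\<^sub>0)) * (\<rho>\<^sub>0 / r) ^ CARD('m) \<and>
          (\<bar>t\<bar> \<le> 1 \<longrightarrow>
           C_norm C (x_proj V C G x0 b0 b1 t - x_krylov C \<gamma> W0 H0 W1 H1 W2 H2 x0 u0 u1 t)
            \<le> (SUP z\<in>sphere (complex_of_real c\<^sub>0) r.
                   cmod (f0 \<gamma> t z) * C_norm C x0
                   + cmod (fk 1 \<gamma> t z) * C_norm C u0
                   + cmod (fk 2 \<gamma> t z) * C_norm C u1)
                * (4 / (r - \<rho>\<^sub>0)) * (\<rho>\<^sub>0 / r) ^ CARD('m))))"
proof -
  obtain L Li where L: "transpose L = L" "L ** L = C1" "L ** Li = mat 1"
    using diagonal_sqrt[of C1] V unfolding reduced_eigen_decomp_def by metis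
  interpret reduced_pencil C G V L Li \<gamma>
    using C G gamma V L by unfold_locales (auto simp: sym_pos_semidef_def reduced_eigen_decomp_def)
  define err where "err = C_norm C (x_proj V C G x0 b0 b1 t - x_krylov C \<gamma> W0 H0 W1 H1 W2 H2 x0 u0 u1 t)"
  \<comment> \<open>Stated for an arbitrary upper bound \<open>M\<close>, so that it covers both suprema.\<close>
  have bound: "err \<le> M * (4 / (r - \<rho>)) * (\<rho> / r) ^ CARD('m)"
    if \<rho>: "0 < \<rho>" "\<rho> < c" "c + \<rho> < 1" and range: "numrange E \<subseteq> cball (of_real c) \<rho>"
      and r: "\<rho> < r" "r < c"
      and M: "\<And>z. z \<in> sphere (of_real c) r \<Longrightarrow> cmod (f0 \<gamma> t z) * C_norm C x0
                   + \<bar>t\<bar> * cmod (fk 1 \<gamma> t z) * C_norm C u0 + t\<^sup>2 * cmod (fk 2 \<gamma> t z) * C_norm C u1 \<le> M"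
    for \<rho> c r M
  proof -
    define m where "m = CARD('m)"
    define h where "h = (\<lambda>k z. if k = 0 then f0 \<gamma> t (of_real c + z) else fk k \<gamma> t (of_real c + z))"
    define tail where "tail k = (\<Sum>j. cmod (taylor (h k) (j + m)) * \<rho> ^ (j + m))" for k
    have nr: "num_radius_le (E - c *\<^sub>R mat 1) \<rho>" by (rule num_radius_le_if_numrange[OF range])
    have h: "h k holomorphic_on ball 0 c" for k
      unfolding h_def using f0_holomorphic[OF order_refl] fk_holomorphic[OF order_refl] by (cases "k = 0") simp_all
    have \<gamma>0: "\<gamma> \<noteq> 0" using gamma by simp
    define e0 where "e0 = f0_mat \<gamma> t E *v (transpose U *v x0) - transpose U *v ((W0 ** f0_mat \<gamma> t H0 ** transpose W0 ** C) *v x0)"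
    define ek where "ek k v W H = fk_mat k \<gamma> t E *v (transpose U *v v) - transpose U *v ((W ** fk_mat k \<gamma> t H ** transpose W ** C) *v v)"
      for k v and W :: "real^('m::{finite,linorder})^'n" and H
    have e0: "norm e0 \<le> 4 * C_norm C x0 * tail 0"
      unfolding e0_def tail_def m_def
      by (rule arnoldi_function_error[OF W0[unfolded S_def] nr \<rho>(1,2) h])
        (simp_all add: f0_mat_eq[OF _ \<rho> \<gamma>0] h_def)
    have ek: "norm (ek k v W H) \<le> 4 * C_norm C v * tail k"
      if "v \<noteq> 0 \<Longrightarrow> arnoldi C S v W H" "t \<noteq> 0" "k > 0" for k v H and W :: "real^('m::{finite,linorder})^'n"
      unfolding ek_def tail_def m_def
      by (rule arnoldi_function_error[OF that(1)[unfolded S_def] nr \<rho>(1,2) h])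
        (use that in \<open>simp_all add: fk_mat_eq[OF _ \<rho> \<gamma>0] h_def\<close>)
    have "transpose U *v (x_proj V C G x0 b0 b1 t - x_krylov C \<gamma> W0 H0 W1 H1 W2 H2 x0 u0 u1 t)
        = e0 + t *\<^sub>R ek 1 u0 W1 H1 + t\<^sup>2 *\<^sub>R ek 2 u1 W2 H2"
      unfolding matrix_vector_mult_diff_distrib x_proj_coordinates[OF b0 b1] x_krylov_def e0_def ek_def
      by (simp add: matrix_vector_right_distrib matrix_vector_mult_scaleR scaleR_diff_right)
    then have "err = norm (e0 + t *\<^sub>R ek 1 u0 W1 H1 + t\<^sup>2 *\<^sub>R ek 2 u1 W2 H2)"
      by (simp add: err_def C_norm_eq)
    also have "\<dots> \<le> norm e0 + norm (t *\<^sub>R ek 1 u0 W1 H1) + norm (t\<^sup>2 *\<^sub>R ek 2 u1 W2 H2)"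
      by (intro norm_triangle_le add_mono order_refl)
    also have "\<dots> \<le> 4 * C_norm C x0 * tail 0 + \<bar>t\<bar> * (4 * C_norm C u0 * tail 1) + t\<^sup>2 * (4 * C_norm C u1 * tail 2)"
    proof (cases "t = 0")
      case False
      then show ?thesis using e0 ek[OF W1] ek[OF W2] by (auto intro!: add_mono mult_left_mono)
    qed (use e0 in simp)
    also have "\<dots> = 4 * (\<Sum>k\<in>{0,1,2}. (\<bar>t\<bar> ^ k * C_norm C (if k = 0 then x0 else if k = 1 then u0 else u1)) * tail k)"
      by (simp add: algebra_simps)
    also have "(\<Sum>k\<in>{0,1,2}. (\<bar>t\<bar> ^ k * C_norm C (if k = 0 then x0 else if k = 1 then u0 else u1)) * tail k)
        \<le> M * r / (r - \<rho>) * (\<rho> / r) ^ m"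
      unfolding tail_def
    proof (rule taylor_tail_sum_bound[OF _ h \<rho>(1) r])
      fix z :: complex assume "cmod z = r"
      then have "of_real c + z \<in> sphere (of_real c) r" by (simp add: dist_norm)
      from M[OF this] show "(\<Sum>k\<in>{0,1,2}. (\<bar>t\<bar> ^ k * C_norm C (if k = 0 then x0 else if k = 1 then u0 else u1)) * cmod (h k z)) \<le> M"
        by (simp add: h_def algebra_simps)
    qed (simp_all add: C_norm_eq)
    \<comment> \<open>The geometric series leaves a factor \<open>r\<close>, and \<open>r < c < 1\<close>.\<close>
    also have "M * r / (r - \<rho>) * (\<rho> / r) ^ m \<le> M * 1 / (r - \<rho>) * (\<rho> / r) ^ m"
    proof -
      have "of_real (c + r) \<in> sphere (complex_of_real c) r" using r \<rho> by (simp add: dist_norm)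
      from M[OF this] have "M \<ge> 0"
        by (rule order_trans[rotated]) (simp add: C_norm_eq)
      then show ?thesis using r \<rho> by (intro mult_right_mono divide_right_mono mult_left_mono) auto
    qed
    finally show ?thesis by (simp add: m_def mult_ac)
  qed
  show ?thesis
  proof (intro conjI allI impI)
    show "0 \<notin> C_numrange C B" unfolding B_def by (rule zero_notin_B)
    show "\<exists>c1 \<rho>1. 0 < \<rho>1 \<and> \<rho>1 < c1 \<and>
       C_numrange C B \<subseteq> cball (complex_of_real c1) \<rho>1 \<and>
       C_numrange C S \<subseteq> cball (complex_of_real (S_center \<gamma> c1 \<rho>1)) (S_radius \<gamma> c1 \<rho>1)"
      unfolding B_def S_def by (rule disks_exist)
  next
    fix c1 \<rho>1 c\<^sub>0 \<rho>\<^sub>0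
    assume A: "0 < \<rho>1 \<and> \<rho>1 < c1 \<and> c\<^sub>0 = S_center \<gamma> c1 \<rho>1 \<and> \<rho>\<^sub>0 = S_radius \<gamma> c1 \<rho>1 \<and>
       C_numrange C B \<subseteq> cball (complex_of_real c1) \<rho>1 \<and>
       C_numrange C S \<subseteq> cball (complex_of_real c\<^sub>0) \<rho>\<^sub>0"
    then have disk: "0 < \<rho>\<^sub>0" "\<rho>\<^sub>0 < c\<^sub>0" "c\<^sub>0 + \<rho>\<^sub>0 < 1" using S_disk[OF gamma, of \<rho>1 c1] by simp_all
    then show "0 < \<rho>\<^sub>0" "\<rho>\<^sub>0 < c\<^sub>0" by simp_all
    have range: "numrange E \<subseteq> cball (of_real c\<^sub>0) \<rho>\<^sub>0" using A unfolding S_def S_numrange by blast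
    fix r assume r: "\<rho>\<^sub>0 < r \<and> r < c\<^sub>0"
    have sphere: "z \<noteq> 0" if "z \<in> sphere (of_real c\<^sub>0) r" for z :: complex
      using that r disk by auto
    have cont: "continuous_on (sphere (of_real c\<^sub>0) r) (f0 \<gamma> t)" "continuous_on (sphere (of_real c\<^sub>0) r) (fk k \<gamma> t)" for k
    proof -
      have g: "continuous_on (sphere (of_real c\<^sub>0) r) (g1_inv \<gamma>)"
        unfolding g1_inv_def using gamma sphere by (intro continuous_intros) auto
      have p: "continuous_on (sphere (of_real c\<^sub>0) r) (\<lambda>z. phi k (- of_real t * g1_inv \<gamma> z))" for k
        by (rule continuous_on_compose2[OF holomorphic_on_imp_continuous_on[OF phi_holomorphic]
              continuous_on_mult[OF continuous_on_const g]]) simp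
      show "continuous_on (sphere (of_real c\<^sub>0) r) (f0 \<gamma> t)" unfolding f0_def by (rule p)
      show "continuous_on (sphere (of_real c\<^sub>0) r) (fk k \<gamma> t)" unfolding fk_def by (rule continuous_on_mult[OF g p])
    qed
    have bdd: "bdd_above ((\<lambda>z. cmod (f0 \<gamma> t z) * p + q * cmod (fk 1 \<gamma> t z) * s + u * cmod (fk 2 \<gamma> t z) * v) ` sphere (of_real c\<^sub>0) r)"
      for p q s u v
      by (intro bounded_imp_bdd_above compact_imp_bounded compact_continuous_image continuous_intros cont compact_sphere)
    note main = bound[OF disk range conjunct1[OF r] conjunct2[OF r]]
    show "C_norm C (x_proj V C G x0 b0 b1 t - x_krylov C \<gamma> W0 H0 W1 H1 W2 H2 x0 u0 u1 t)
            \<le> (SUP z\<in>sphere (complex_of_real c\<^sub>0) r.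
                   cmod (f0 \<gamma> t z) * C_norm C x0
                   + \<bar>t\<bar> * cmod (fk 1 \<gamma> t z) * C_norm C u0
                   + t\<^sup>2 * cmod (fk 2 \<gamma> t z) * C_norm C u1)
                * (4 / (r - \<rho>\<^sub>0)) * (\<rho>\<^sub>0 / r) ^ CARD('m)"
      unfolding err_def[symmetric] by (rule main, rule cSUP_upper[OF _ bdd])
    assume t: "\<bar>t\<bar> \<le> 1"
    show "C_norm C (x_proj V C G x0 b0 b1 t - x_krylov C \<gamma> W0 H0 W1 H1 W2 H2 x0 u0 u1 t)
            \<le> (SUP z\<in>sphere (complex_of_real c\<^sub>0) r.
                   cmod (f0 \<gamma> t z) * C_norm C x0
                   + cmod (fk 1 \<gamma> t z) * C_norm C u0
                   + cmod (fk 2 \<gamma> t z) * C_norm C u1)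
                * (4 / (r - \<rho>\<^sub>0)) * (\<rho>\<^sub>0 / r) ^ CARD('m)"
      unfolding err_def[symmetric]
    proof (rule main)
      fix z :: complex assume z: "z \<in> sphere (of_real c\<^sub>0) r"
      have "t\<^sup>2 \<le> 1" using t by (simp add: abs_square_le_1)
      then have "cmod (f0 \<gamma> t z) * C_norm C x0 + \<bar>t\<bar> * cmod (fk 1 \<gamma> t z) * C_norm C u0 + t\<^sup>2 * cmod (fk 2 \<gamma> t z) * C_norm C u1
         \<le> cmod (f0 \<gamma> t z) * C_norm C x0 + 1 * cmod (fk 1 \<gamma> t z) * C_norm C u0 + 1 * cmod (fk 2 \<gamma> t z) * C_norm C u1"
        using t by (intro add_mono mult_right_mono order_refl) (simp_all add: C_norm_eq)
      also have "\<dots> \<le> (SUP z\<in>sphere (complex_of_real c\<^sub>0) r.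
                   cmod (f0 \<gamma> t z) * C_norm C x0
                   + cmod (fk 1 \<gamma> t z) * C_norm C u0
                   + cmod (fk 2 \<gamma> t z) * C_norm C u1)"
        using cSUP_upper[OF z bdd[of _ 1 _ 1]] by simp
      finally show "cmod (f0 \<gamma> t z) * C_norm C x0 + \<bar>t\<bar> * cmod (fk 1 \<gamma> t z) * C_norm C u0 + t\<^sup>2 * cmod (fk 2 \<gamma> t z) * C_norm C u1
         \<le> (SUP z\<in>sphere (complex_of_real c\<^sub>0) r.
                   cmod (f0 \<gamma> t z) * C_norm C x0
                   + cmod (fk 1 \<gamma> t z) * C_norm C u0
                   + cmod (fk 2 \<gamma> t z) * C_norm C u1)" .
    qed
  qed
qed

end
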